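(* Let $L$ be a finite simplicial complex with vertex set $[m]=\{1,\dots,m\}$. For each $i\in[m]$, let $E_i$ be a finite set (with the discrete topology) of cardinality $q_i+1$, and let $\operatorname{Cone}E_i$ be the cone on $E_i$. Put $(\mathbf{Cone}\,\mathbf{E},\mathbf{E})=\{(\operatorname{Cone}E_i,E_i)\}_{i\in[m]}$ and $\mathbf{q}=(q_i)_{i\in[m]}$. Then $$\chi(\mathcal{Z}_L(\mathbf{Cone}\,\mathbf{E},\mathbf{E}))=\hat{h}_L(-\mathbf{q}).$$
   Context: $\mathcal{S}(L)$ denotes the poset of vertex sets of simplices of $L$, including the empty simplex $\emptyset$; so $\mathcal{S}(L)$ is a collection of subsets of $[m]$. For a family $(\mathbf{A},\mathbf{B})=\{(A_i,B_i)\}_{i\in[m]}$ of pairs of finite CW complexes ($B_i$ a subcomplex of $A_i$) and a point $\mathbf{x}=(x_i)_{i\in[m]}$ of $\prod\mathbf{A}:=\prod_{i\in[m]}A_i$, put $\operatorname{Supp}(\mathbf{x}):=\{i\in[m]\mid x_i\notin B_i\}$. The polyhedral product is the subspace $$\mathcal{Z}_L(\mathbf{A},\mathbf{B})=\{\mathbf{x}\in\prod\mathbf{A}\mid \operatorname{Supp}(\mathbf{x})\in\mathcal{S}(L)\}.$$ Here $\chi$ is the Euler characteristic. The cone $\operatorname{Cone}E_i$ is the $1$-dimensional complex consisting of a cone vertex joined by an edge to each element of $E_i$, and $E_i\subset\operatorname{Cone}E_i$ is the base of the cone. For an $m$-tuple $\mathbf{t}=(t_i)_{i\in[m]}$ and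 $J\subseteq[m]$, $\mathbf{t}_J:=\prod_{j\in J}t_j$ (so $\mathbf{t}_\emptyset=1$). The $f$-polynomial of $L$ is the polynomial in indeterminates $\mathbf{t}=(t_i)_{i\in[m]}$ given by $f_L(\mathbf{t})=\sum_{J\in\mathcal{S}(L)}\mathbf{t}_J$. The $\hat{h}$-polynomial of $L$ is $$\hat{h}_L(\mathbf{t}):=(\mathbf{1}-\mathbf{t})_{[m]}\,f_L\left(\frac{\mathbf{t}}{\mathbf{1}-\mathbf{t}}\right),$$ where $\mathbf{1}=(1,\dots,1)$ and $\frac{\mathbf{t}}{\mathbf{1}-\mathbf{t}}$ is the $m$-tuple $\left(\frac{t_i}{1-t_i}\right)_{i\in[m]}$; this is a polynomial in the $t_i$. *)

theory Defs
  imports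
    "HOL-Homology.Homology"
    "HOL-Library.Poly_Mapping"
    "HOL-Computational_Algebra.Fraction_Field"
begin

definition int_independent :: "('a, 'b) monoid_scheme \<Rightarrow> 'a set \<Rightarrow> bool" where
  "int_independent G S \<longleftrightarrow> finite S \<and> S \<subseteq> carrier G \<and>
     (\<forall>c :: 'a \<Rightarrow> int. (\<Otimes>\<^bsub>G\<^esub>s\<in>S. s [^]\<^bsub>G\<^esub> c s) = \<one>\<^bsub>G\<^esub> \<longrightarrow> (\<forall>s\<in>S. c s = 0))"

text \<open>Rank of a multiplicatively written abelian group; only meaningful when the rank is finite.\<close>

definition abelian_rank :: "('a, 'b) monoid_scheme \<Rightarrow> nat" where
  "abelian_rank G = Sup {card S | S. int_independent G S}"

definition betti_number :: "nat \<Rightarrow> 'a topology \<Rightarrow> nat" where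
  "betti_number p X = abelian_rank (homology_group (int p) X)"

text \<open>Only meaningful for spaces with finitely generated total singular homology, such as
  finite CW complexes.\<close>

definition euler_characteristic :: "'a topology \<Rightarrow> int" where
  "euler_characteristic X =
     (\<Sum>p | betti_number p X \<noteq> 0. (-1) ^ p * int (betti_number p X))"

text \<open>A finite simplicial complex with vertex set \<open>V\<close> is given by its collection of simplices,
  the empty simplex included.\<close>

definition finite_simplicial_complex :: "'v set \<Rightarrow> 'v set set \<Rightarrow> bool" where
  "finite_simplicial_complex V K \<longleftrightarrow> finite V \<and> K \<subseteq> Pow V \<and> {} \<in> K \<and>
     (\<forall>v\<in>V. {v} \<in> K) \<and> (\<forall>\<sigma>\<in>K. \<forall>\<tau>. \<tau> \<subseteq> \<sigma> \<longrightarrow> \<tau> \<in> K)"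

text \<open>Points are given by barycentric coordinates. For a finite complex the subspace topology
  used here is the usual (weak) topology.\<close>

definition geometric_realization :: "'v set set \<Rightarrow> ('v \<Rightarrow> real) topology" where
  "geometric_realization K = subtopology (powertop_real UNIV)
     {x. (\<forall>v. 0 \<le> x v) \<and> {v. x v \<noteq> 0} \<in> K \<and> (\<Sum>v | x v \<noteq> 0. x v) = 1}"

definition vertex_point :: "'v \<Rightarrow> 'v \<Rightarrow> real" where
  "vertex_point v = (\<lambda>w. if w = v then 1 else 0)"

text \<open>The cone vertex is \<open>None\<close>; the element \<open>e\<close> of \<open>E\<close> is the vertex \<open>Some e\<close>.\<close>

definition cone_complex :: "'a set \<Rightarrow> 'a option set set" where
  "cone_complex E = {{}, {None}} \<union> (\<lambda>e. {Some e}) ` E \<union> (\<lambda>e. {None, Some e}) ` E"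

definition cone_space :: "'a set \<Rightarrow> ('a option \<Rightarrow> real) topology" where
  "cone_space E = geometric_realization (cone_complex E)"

definition cone_base :: "'a set \<Rightarrow> ('a option \<Rightarrow> real) set" where
  "cone_base E = (\<lambda>e. vertex_point (Some e)) ` E"

definition point_support :: "'i set \<Rightarrow> ('i \<Rightarrow> 'a set) \<Rightarrow> ('i \<Rightarrow> 'a) \<Rightarrow> 'i set" where
  "point_support I B x = {i \<in> I. x i \<notin> B i}"

definition polyhedral_product ::
  "'i set \<Rightarrow> 'i set set \<Rightarrow> ('i \<Rightarrow> 'a topology) \<Rightarrow> ('i \<Rightarrow> 'a set) \<Rightarrow> ('i \<Rightarrow> 'a) topology" where
  "polyhedral_product I K A B =
     subtopology (product_topology A I) {x. point_support I B x \<in> K}"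

text \<open>Polynomials with integer coefficients in indeterminates indexed by \<open>nat\<close>: a monomial is a
  finitely supported exponent vector.\<close>

type_synonym int_mpoly = "(nat \<Rightarrow>\<^sub>0 nat) \<Rightarrow>\<^sub>0 int"

definition indet :: "nat \<Rightarrow> int_mpoly" where
  "indet i = Poly_Mapping.single (Poly_Mapping.single i 1) 1"

definition mpoly_eval :: "(nat \<Rightarrow> 'r::comm_ring_1) \<Rightarrow> int_mpoly \<Rightarrow> 'r" where
  "mpoly_eval t p = (\<Sum>k \<in> Poly_Mapping.keys p. of_int (Poly_Mapping.lookup p k) *
     (\<Prod>i \<in> Poly_Mapping.keys k. t i ^ Poly_Mapping.lookup k i))"

definition f_poly :: "nat set set \<Rightarrow> int_mpoly" where
  "f_poly K = (\<Sum>J\<in>K. \<Prod>j\<in>J. indet j)"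

text \<open>The defining expression lives in the field of rational functions \<open>int_mpoly fract\<close>;
  \<open>h_hat_poly V K\<close> is the polynomial it is equal to, cf. \<open>h_hat_poly_eq\<close> below.\<close>

definition h_hat_poly :: "nat set \<Rightarrow> nat set set \<Rightarrow> int_mpoly" where
  "h_hat_poly V K = (THE h. Fract h 1 =
     (\<Prod>i\<in>V. 1 - Fract (indet i) 1) *
     mpoly_eval (\<lambda>i. Fract (indet i) 1 / (1 - Fract (indet i) 1)) (f_poly K))"

lemma mpoly_eval_superset:
  assumes "finite F" "Poly_Mapping.keys p \<subseteq> F"
  shows "mpoly_eval t p = (\<Sum>k \<in> F. of_int (Poly_Mapping.lookup p k) *
     (\<Prod>i \<in> Poly_Mapping.keys k. t i ^ Poly_Mapping.lookup k i))"
  unfolding mpoly_eval_def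
  by (rule sum.mono_neutral_left) (use assms in \<open>auto simp: in_keys_iff\<close>)

lemma mpoly_eval_0: "mpoly_eval t 0 = 0"
  by (simp add: mpoly_eval_def)

lemma mpoly_eval_add: "mpoly_eval t (p + q) = mpoly_eval t p + mpoly_eval t q"
proof -
  let ?F = "Poly_Mapping.keys p \<union> Poly_Mapping.keys q"
  have "Poly_Mapping.keys (p + q) \<subseteq> ?F" by (rule Poly_Mapping.keys_add)
  then show ?thesis
    by (simp add: mpoly_eval_superset[of ?F] lookup_add ring_distribs sum.distrib)
qed

lemma mpoly_eval_sum: "mpoly_eval t (sum f S) = (\<Sum>s\<in>S. mpoly_eval t (f s))"
  by (induction S rule: infinite_finite_induct) (auto simp: mpoly_eval_0 mpoly_eval_add)

lemma prod_indet:
  "finite J \<Longrightarrow> (\<Prod>j\<in>J. indet j) = Poly_Mapping.single (\<Sum>j\<in>J. Poly_Mapping.single j 1) 1"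
  by (induction J rule: finite_induct) (auto simp: indet_def mult_single)

lemma lookup_sum_single:
  "finite J \<Longrightarrow> Poly_Mapping.lookup (\<Sum>j\<in>J. Poly_Mapping.single j (1::nat)) i = (if i \<in> J then 1 else 0)"
  by (induction J rule: finite_induct) (auto simp: lookup_add lookup_single when_def)

lemma mpoly_eval_prod_indet:
  assumes "finite J"
  shows "mpoly_eval t (\<Prod>j\<in>J. indet j) = (\<Prod>j\<in>J. t j)"
proof -
  let ?k = "\<Sum>j\<in>J. Poly_Mapping.single j (1::nat)"
  have "Poly_Mapping.keys ?k = J"
    by (auto simp: in_keys_iff lookup_sum_single[OF assms, unfolded One_nat_def] split: if_splits)
  then show ?thesis
    by (simp add: prod_indet[OF assms] mpoly_eval_def lookup_sum_single[OF assms, unfolded One_nat_def])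
qed

lemma mpoly_eval_f_poly:
  assumes "finite_simplicial_complex V K"
  shows "mpoly_eval t (f_poly K) = (\<Sum>J\<in>K. \<Prod>j\<in>J. t j)"
proof -
  have "finite J" if "J \<in> K" for J
    using assms that by (auto simp: finite_simplicial_complex_def intro: finite_subset)
  then show ?thesis
    by (simp add: f_poly_def mpoly_eval_sum mpoly_eval_prod_indet)
qed

lemma Fract_one_add: "Fract (a + b) 1 = Fract a 1 + Fract (b :: 'a::idom) 1"
  by simp

lemma Fract_one_mult: "Fract (a * b) 1 = Fract a 1 * Fract (b :: 'a::idom) 1"
  by simp

lemma Fract_one_diff: "1 - Fract a 1 = Fract (1 - a :: 'a::idom) 1"
  by (simp add: One_fract_def)

lemma Fract_one_eq_0: "Fract a 1 = 0 \<longleftrightarrow> a = (0 :: 'a::idom)"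
  unfolding Zero_fract_def by (subst eq_fract) auto

lemma Fract_one_sum: "Fract (sum f S) 1 = (\<Sum>s\<in>S. Fract (f s :: 'a::idom) 1)"
  by (induction S rule: infinite_finite_induct) (simp_all add: Zero_fract_def Fract_one_add del: add_fract)

lemma Fract_one_prod: "Fract (prod f S) 1 = (\<Prod>s\<in>S. Fract (f s :: 'a::idom) 1)"
  by (induction S rule: infinite_finite_induct)
     (simp_all add: One_fract_def Fract_one_mult del: mult_fract)

lemma prod_ratio:
  fixes t :: "'i \<Rightarrow> 'f::field"
  assumes "finite V" "J \<subseteq> V" "\<And>i. 1 - t i \<noteq> 0"
  shows "(\<Prod>i\<in>V. 1 - t i) * (\<Prod>j\<in>J. t j / (1 - t j)) = (\<Prod>j\<in>J. t j) * (\<Prod>i\<in>V - J. 1 - t i)"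
proof -
  have "(\<Prod>i\<in>V. 1 - t i) = (\<Prod>i\<in>V - J. 1 - t i) * (\<Prod>i\<in>J. 1 - t i)"
    using assms by (intro prod.subset_diff)
  moreover have "(\<Prod>i\<in>J. 1 - t i) \<noteq> 0"
    using assms finite_subset[of J V] by (simp add: prod_zero_iff)
  ultimately show ?thesis by (simp add: prod_dividef)
qed

lemma indet_neq_1: "indet i \<noteq> 1"
proof
  assume "indet i = 1"
  then have "Poly_Mapping.lookup (indet i) 0 = Poly_Mapping.lookup (1 :: int_mpoly) 0" by simp
  moreover have "Poly_Mapping.single i (1::nat) \<noteq> 0"
    by (metis lookup_single_eq lookup_zero zero_neq_one)
  ultimately show False
    by (simp add: indet_def lookup_single lookup_one)
qed

lemma h_hat_poly_eq:
  assumes K: "finite_simplicial_complex V K"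
  shows "h_hat_poly V K = (\<Sum>J\<in>K. (\<Prod>j\<in>J. indet j) * (\<Prod>i\<in>V - J. 1 - indet i))"
    (is "_ = ?h")
    and "Fract (h_hat_poly V K) 1 = (\<Prod>i\<in>V. 1 - Fract (indet i) 1) *
      mpoly_eval (\<lambda>i. Fract (indet i) 1 / (1 - Fract (indet i) 1)) (f_poly K)"
    (is "_ = ?r")
proof -
  let ?t = "\<lambda>i. Fract (indet i) 1"
  have nz: "1 - ?t i \<noteq> 0" for i
    using indet_neq_1[of i] unfolding Fract_one_diff Fract_one_eq_0 by simp
  have fin: "finite V" using K by (simp add: finite_simplicial_complex_def)
  have "(\<Prod>i\<in>V. 1 - ?t i) * (\<Prod>j\<in>J. ?t j / (1 - ?t j)) = (\<Prod>j\<in>J. ?t j) * (\<Prod>i\<in>V - J. 1 - ?t i)"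
    if "J \<in> K" for J
    using K that fin nz by (intro prod_ratio) (auto simp: finite_simplicial_complex_def)
  then have "?r = (\<Sum>J\<in>K. (\<Prod>j\<in>J. ?t j) * (\<Prod>i\<in>V - J. 1 - ?t i))"
    unfolding mpoly_eval_f_poly[OF K] sum_distrib_left by (rule sum.cong[OF refl])
  then have r: "?r = Fract ?h 1"
    unfolding Fract_one_sum Fract_one_mult Fract_one_prod Fract_one_diff .
  then show "h_hat_poly V K = ?h"
    unfolding h_hat_poly_def by (intro the_equality) (auto simp: eq_fract)
  then show "Fract (h_hat_poly V K) 1 = ?r" using r by simp
qed

end

theory Submission
  imports Defs
begin

text \<open>
  The proof is a recursion on the vertex set. Fix a vertex \<open>m\<close>, let \<open>Z\<close> be the polyhedral product
  of the complex \<open>K\<close>, and let \<open>Z\<^sub>d\<close> and \<open>Z\<^sub>l\<close> be the polyhedral products, over the remaining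
  vertices, of the deletion and the link of \<open>m\<close>. The points of \<open>Z\<close> whose coordinate \<open>m\<close> is not a
  base point form an open set that contracts to \<open>Z\<^sub>l\<close>. For each \<open>e \<in> E m\<close>, the points whose
  coordinate \<open>m\<close> lies on the edge over \<open>e\<close>, away from the cone vertex, form an open set that
  contracts to \<open>Z\<^sub>d\<close>; it meets the former set in an open set contracting to \<open>Z\<^sub>l\<close> again, and
  these sets are disjoint for distinct \<open>e\<close>. Hence, by additivity of the Euler characteristic,
  \<open>\<chi>(Z) = |E m| \<chi>(Z\<^sub>d) + (1 - |E m|) \<chi>(Z\<^sub>l)\<close> (\<open>has_rel_euler_link_deletion\<close>). The sum of
  \<open>(\<Prod>j\<in>J. 1 - |E j|) (\<Prod>i\<in>I - J. |E i|)\<close> over the simplices \<open>J\<close> satisfies the same recursion,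
  and for \<open>|E i| = q i + 1\<close> it is the value of the polynomial at \<open>-q\<close>.

  The homotopy equivalences all come from one lemma
  (\<open>polyhedral_product_slab_homotopy_equivalent\<close>): contracting a single coordinate without leaving
  the base never enlarges supports.

  Additivity for open covers (\<open>has_rel_euler_Un\<close>) follows from the long exact sequence of a pair
  and excision, once ranks are known to be additive along exact sequences (\<open>rank_nullity\<close>). Rank
  here is the largest size of a set without integer relations, possibly in a group with torsion,
  and its additivity is proved directly from that description.
\<close>

section \<open>Independence and rank in abelian groups\<close>

text \<open>Independence of a set is reindexed to families because the members that matter below are
  images or lifts of other elements; an independent family is automatically injective, so it
  yields an independent set of the same size.\<close>

definition indep_family :: "('a, 'b) monoid_scheme \<Rightarrow> 'i set \<Rightarrow> ('i \<Rightarrow> 'a) \<Rightarrow> bool" where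
  "indep_family G I g \<longleftrightarrow> finite I \<and> g \<in> I \<rightarrow> carrier G \<and>
     (\<forall>c :: 'i \<Rightarrow> int. (\<Otimes>\<^bsub>G\<^esub>i\<in>I. g i [^]\<^bsub>G\<^esub> c i) = \<one>\<^bsub>G\<^esub> \<longrightarrow> (\<forall>i\<in>I. c i = 0))"

lemma indep_familyD:
  assumes "indep_family G I g" "(\<Otimes>\<^bsub>G\<^esub>i\<in>I. g i [^]\<^bsub>G\<^esub> (c i :: int)) = \<one>\<^bsub>G\<^esub>" "i \<in> I"
  shows "c i = 0"
  using assms unfolding indep_family_def by blast

lemma int_independentD:
  assumes "int_independent G S" "(\<Otimes>\<^bsub>G\<^esub>s\<in>S. s [^]\<^bsub>G\<^esub> (c s :: int)) = \<one>\<^bsub>G\<^esub>" "s \<in> S"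
  shows "c s = 0"
  using assms unfolding int_independent_def by blast

lemma (in comm_group) finprod_int_pow:
  assumes "g \<in> I \<rightarrow> carrier G"
  shows "(\<Otimes>i\<in>I. g i [^] (c i :: int)) [^] (n :: int) = (\<Otimes>i\<in>I. g i [^] (n * c i))"
  using assms
proof (induction I rule: infinite_finite_induct)
  case (insert i I)
  then have "(\<lambda>i. g i [^] c i) \<in> I \<rightarrow> carrier G" "(\<lambda>i. g i [^] (n * c i)) \<in> I \<rightarrow> carrier G" "g i \<in> carrier G"
    by auto
  with insert show ?case
    by (simp add: int_pow_distrib int_pow_pow mult.commute)
qed auto

text \<open>A relation between products of powers is a relation between the original elements whose
  exponents come from multiplying by the coefficient matrix.\<close>

lemma (in comm_group) finprod_int_pow_sum:
  assumes g: "g \<in> I \<rightarrow> carrier G"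
  shows "finite T \<Longrightarrow> (\<Otimes>r\<in>T. (\<Otimes>i\<in>I. g i [^] (C r i :: int)) [^] (d r :: int))
    = (\<Otimes>i\<in>I. g i [^] (\<Sum>r\<in>T. d r * C r i))"
proof (induction T rule: finite_induct)
  case empty
  then show ?case by simp
next
  case (insert r T)
  have cl: "(\<Otimes>i\<in>I. g i [^] (c i :: int)) \<in> carrier G" for c
    using g by (intro finprod_closed) auto
  have "(\<Otimes>r\<in>insert r T. (\<Otimes>i\<in>I. g i [^] C r i) [^] d r)
      = (\<Otimes>i\<in>I. g i [^] C r i) [^] d r \<otimes> (\<Otimes>r\<in>T. (\<Otimes>i\<in>I. g i [^] C r i) [^] d r)"
    using insert.hyps cl by (intro finprod_insert) auto
  also have "\<dots> = (\<Otimes>i\<in>I. g i [^] (d r * C r i)) \<otimes> (\<Otimes>i\<in>I. g i [^] (\<Sum>r\<in>T. d r * C r i))"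
    unfolding insert.IH by (simp only: finprod_int_pow[OF g])
  also have "\<dots> = (\<Otimes>i\<in>I. g i [^] (d r * C r i) \<otimes> g i [^] (\<Sum>r\<in>T. d r * C r i))"
    using g by (intro finprod_multf[symmetric]) auto
  also have "\<dots> = (\<Otimes>i\<in>I. g i [^] (\<Sum>r\<in>insert r T. d r * C r i))"
    using g insert.hyps by (intro finprod_cong') (auto simp: int_pow_mult Pi_iff)
  finally show ?case .
qed

text \<open>If \<open>g i = g j\<close>, then \<open>g i\<close> times the inverse of \<open>g j\<close> would be a nontrivial relation.\<close>

lemma (in comm_group) indep_family_inj_on:
  assumes ind: "indep_family G I g"
  shows "inj_on g I"
proof (rule inj_onI, rule ccontr)
  fix i j assume ij: "i \<in> I" "j \<in> I" "g i = g j" "i \<noteq> j"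
  define c :: "_ \<Rightarrow> int" where "c = (\<lambda>k. if k = i then 1 else if k = j then -1 else 0)"
  have g: "g \<in> I \<rightarrow> carrier G" and fin: "finite I" using ind by (auto simp: indep_family_def)
  have "(\<Otimes>k\<in>I. g k [^] c k) = (\<Otimes>k\<in>{i,j}. g k [^] c k)"
    using ij g fin by (intro finprod_mono_neutral_cong_right) (auto simp: c_def)
  also have "\<dots> = \<one>"
    using ij g by (auto simp: c_def int_pow_neg Pi_iff)
  finally have "c i = 0" using ij(1) by (rule indep_familyD[OF ind])
  then show False by (simp add: c_def)
qed

lemma (in comm_group) indep_family_image:
  assumes ind: "indep_family G I g"
  shows "int_independent G (g ` I)"
proof -
  have g: "g \<in> I \<rightarrow> carrier G" and fin: "finite I" using ind by (auto simp: indep_family_def)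
  have "(\<Otimes>s\<in>g ` I. s [^] c s) = (\<Otimes>i\<in>I. g i [^] c (g i))" for c :: "_ \<Rightarrow> int"
    using g by (intro finprod_reindex indep_family_inj_on[OF ind]) auto
  then show ?thesis
    using ind by (auto simp: int_independent_def indep_family_def)
qed

lemma (in group_hom) hom_finprod_int_pow:
  assumes "comm_group G" "comm_group H" "g \<in> I \<rightarrow> carrier G"
  shows "h (\<Otimes>\<^bsub>G\<^esub>i\<in>I. g i [^]\<^bsub>G\<^esub> (c i :: int)) = (\<Otimes>\<^bsub>H\<^esub>i\<in>I. h (g i) [^]\<^bsub>H\<^esub> c i)"
proof -
  interpret G: comm_group G by fact
  interpret H: comm_group H by fact
  show ?thesis
    using assms(3)
  proof (induction I rule: infinite_finite_induct)
    case (insert i I)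
    then have "(\<lambda>i. g i [^]\<^bsub>G\<^esub> c i) \<in> I \<rightarrow> carrier G" "(\<lambda>i. h (g i) [^]\<^bsub>H\<^esub> c i) \<in> I \<rightarrow> carrier H" "g i \<in> carrier G"
      by (auto intro!: G.int_pow_closed H.int_pow_closed hom_closed)
    with insert show ?case by (simp add: hom_int_pow)
  qed auto
qed

locale comm_group_hom = group_hom G H h + G: comm_group G + H: comm_group H
  for G (structure) and H (structure) and h

text \<open>Applying \<open>h\<close> to a relation kills the part in the kernel, so the exponents on \<open>U\<close> vanish
  first; what remains is a relation on \<open>S\<close>.\<close>

lemma (in comm_group_hom) int_independent_Un_lift:
  assumes S: "S \<subseteq> kernel G H h" "int_independent G S"
    and U: "U \<subseteq> carrier G" "indep_family H U h"
  shows "int_independent G (S \<union> U)" "S \<inter> U = {}"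
proof -
  have fS: "finite S" "S \<subseteq> carrier G" and fU: "finite U"
    using S U by (auto simp: int_independent_def indep_family_def)
  have hS: "h s = \<one>\<^bsub>H\<^esub>" if "s \<in> S" for s using S that by (auto simp: kernel_def)
  show disj: "S \<inter> U = {}"
  proof (rule ccontr)
    assume "S \<inter> U \<noteq> {}"
    then obtain x where x: "x \<in> S" "x \<in> U" by auto
    define c :: "_ \<Rightarrow> int" where "c = (\<lambda>k. if k = x then 1 else 0)"
    have "(\<Otimes>\<^bsub>H\<^esub>k\<in>U. h k [^]\<^bsub>H\<^esub> c k) = \<one>\<^bsub>H\<^esub>"
      using hS[OF x(1)] by (intro H.finprod_one_eqI) (auto simp: c_def)
    then have "c x = 0" using x(2) by (rule indep_familyD[OF U(2)])
    then show False by (simp add: c_def)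
  qed
  have "c i = 0" if eq: "(\<Otimes>s\<in>S \<union> U. s [^] c s) = \<one>" and i: "i \<in> S \<union> U" for c :: "_ \<Rightarrow> int" and i
  proof -
    have "(\<Otimes>\<^bsub>H\<^esub>s\<in>U. h s [^]\<^bsub>H\<^esub> c s) = (\<Otimes>\<^bsub>H\<^esub>s\<in>S \<union> U. h s [^]\<^bsub>H\<^esub> c s)"
      using fS U fU hS disj by (intro H.finprod_mono_neutral_cong_left) auto
    also have "\<dots> = h (\<Otimes>s\<in>S \<union> U. s [^] c s)"
      using fS U by (intro hom_finprod_int_pow[symmetric] G.comm_group_axioms H.comm_group_axioms) auto
    finally have cU: "c s = 0" if "s \<in> U" for s
      by (intro indep_familyD[OF U(2) _ that]) (simp add: eq)
    have "(\<Otimes>s\<in>S. s [^] c s) = (\<Otimes>s\<in>S \<union> U. s [^] c s)"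
      using fS U fU disj cU by (intro G.finprod_mono_neutral_cong_left) auto
    then have "(\<Otimes>s\<in>S. s [^] c s) = \<one>" using eq by simp
    then have "c i = 0" if "i \<in> S" using that by (rule int_independentD[OF S(2)])
    then show "c i = 0" using i cU by blast
  qed
  then show "int_independent G (S \<union> U)"
    using fS fU U by (auto simp: int_independent_def)
qed

text \<open>This is the upper bound for the rank of \<open>G\<close>, and it avoids any exchange argument: choose
  \<open>R1 \<subseteq> R\<close> maximal such that \<open>h\<close> is independent on it. Every other \<open>r \<in> R\<close> then satisfies a relation
  together with \<open>R1\<close> after applying \<open>h\<close>, that is, some nonzero power of \<open>r\<close> times an element
  generated by \<open>R1\<close> lies in the kernel. These kernel elements are independent because each
  involves only one element of \<open>R - R1\<close>.\<close>

lemma (in comm_group_hom) int_independent_split: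
  assumes R: "int_independent G R"
  obtains S T where "S \<subseteq> kernel G H h" "int_independent G S"
    "T \<subseteq> h ` carrier G" "int_independent H T" "card R = card S + card T"
proof -
  have finR: "finite R" and RG: "R \<subseteq> carrier G" using R by (auto simp: int_independent_def)
  have "{} \<subseteq> R \<and> indep_family H {} h" by (simp add: indep_family_def)
  then obtain R1 where R1: "R1 \<subseteq> R" "indep_family H R1 h"
    and max: "\<forall>Q. Q \<subseteq> R \<and> indep_family H Q h \<longrightarrow> card Q \<le> card R1"
    using ex_has_greatest_nat[of "\<lambda>Q. Q \<subseteq> R \<and> indep_family H Q h" "{}" card "Suc (card R)"]
      card_mono[OF finR] by (auto simp: less_Suc_eq_le)
  have finR1: "finite R1" using R1 finR finite_subset by auto
  define D where "D = R - R1"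
  \<comment> \<open>The relation of r with R1, extended by exponent 0 to all of R, so that one product over R serves every r.\<close>
  have "\<exists>c :: _ \<Rightarrow> int. (\<Otimes>\<^bsub>H\<^esub>s\<in>R. h s [^]\<^bsub>H\<^esub> c s) = \<one>\<^bsub>H\<^esub> \<and> c r \<noteq> 0 \<and> (\<forall>s\<in>D. s \<noteq> r \<longrightarrow> c s = 0)"
    if r: "r \<in> D" for r
  proof -
    have rR: "insert r R1 \<subseteq> R" "r \<notin> R1" using r R1 by (auto simp: D_def)
    then have "\<not> indep_family H (insert r R1) h"
      using max[rule_format, of "insert r R1"] finR1 by auto
    then obtain c :: "_ \<Rightarrow> int" and j where c: "(\<Otimes>\<^bsub>H\<^esub>s\<in>insert r R1. h s [^]\<^bsub>H\<^esub> c s) = \<one>\<^bsub>H\<^esub>"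
      and j: "j \<in> insert r R1" "c j \<noteq> 0"
      using rR RG finR1 by (auto simp: indep_family_def)
    have "c r \<noteq> 0"
    proof
      assume cr: "c r = 0"
      have "(\<Otimes>\<^bsub>H\<^esub>s\<in>R1. h s [^]\<^bsub>H\<^esub> c s) = (\<Otimes>\<^bsub>H\<^esub>s\<in>insert r R1. h s [^]\<^bsub>H\<^esub> c s)"
        using rR RG finR1 cr by (intro H.finprod_mono_neutral_cong_left) auto
      with c have "(\<Otimes>\<^bsub>H\<^esub>s\<in>R1. h s [^]\<^bsub>H\<^esub> c s) = \<one>\<^bsub>H\<^esub>" by simp
      then have "\<forall>i\<in>R1. c i = 0" using indep_familyD[OF R1(2)] by blast
      with cr j show False by auto
    qed
    moreover have "(\<Otimes>\<^bsub>H\<^esub>s\<in>R. h s [^]\<^bsub>H\<^esub> (if s \<in> insert r R1 then c s else 0)) = \<one>\<^bsub>H\<^esub>"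
      unfolding c[symmetric] using rR RG finR
      by (intro H.finprod_mono_neutral_cong_right) auto
    ultimately show ?thesis
      by (intro exI[of _ "\<lambda>s. if s \<in> insert r R1 then c s else 0"]) (auto simp: D_def)
  qed
  then obtain C :: "_ \<Rightarrow> _ \<Rightarrow> int" where
    C1: "\<And>r. r \<in> D \<Longrightarrow> (\<Otimes>\<^bsub>H\<^esub>s\<in>R. h s [^]\<^bsub>H\<^esub> C r s) = \<one>\<^bsub>H\<^esub>"
    and C2: "\<And>r. r \<in> D \<Longrightarrow> C r r \<noteq> 0"
    and C3: "\<And>r s. r \<in> D \<Longrightarrow> s \<in> D \<Longrightarrow> s \<noteq> r \<Longrightarrow> C r s = 0"
    by metis
  define k where "k r = (\<Otimes>s\<in>R. s [^] C r s)" for r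
  have kG: "k r \<in> carrier G" for r
    unfolding k_def using RG by (intro G.finprod_closed) auto
  have kk: "k r \<in> kernel G H h" if "r \<in> D" for r
    using kG[of r] C1[OF that] RG hom_finprod_int_pow[OF G.comm_group_axioms H.comm_group_axioms, of "\<lambda>x. x" R "C r"]
    by (auto simp: kernel_def k_def)
  have finD: "finite D" using finR by (simp add: D_def)
  have ind: "indep_family G D k"
    unfolding indep_family_def
  proof (intro conjI allI impI ballI)
    show "k \<in> D \<rightarrow> carrier G" using kG by auto
    fix d :: "_ \<Rightarrow> int" and i
    assume eq: "(\<Otimes>i\<in>D. k i [^] d i) = \<one>" and i: "i \<in> D"
    have "(\<Otimes>s\<in>R. s [^] (\<Sum>r\<in>D. d r * C r s)) = \<one>"
      using G.finprod_int_pow_sum[of "\<lambda>x. x" R D C d] RG finD eq unfolding k_def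
      by (metis (no_types, lifting) Pi_I subsetD)
    then have "(\<Sum>r\<in>D. d r * C r i) = 0"
      by (rule int_independentD[OF R]) (use i in \<open>simp add: D_def\<close>)
    moreover have "(\<Sum>r\<in>D. d r * C r i) = (\<Sum>r\<in>{i}. d r * C r i)"
      using finD i C3 by (intro sum.mono_neutral_right) auto
    ultimately show "d i = 0" using C2[OF i] by simp
  qed (rule finD)
  show ?thesis
  proof
    show "k ` D \<subseteq> kernel G H h" using kk by auto
    show "int_independent G (k ` D)" by (rule G.indep_family_image[OF ind])
    show "h ` R1 \<subseteq> h ` carrier G" using R1 RG by auto
    show "int_independent H (h ` R1)" by (rule H.indep_family_image[OF R1(2)])
    have "card R = card D + card R1"
      unfolding D_def using R1(1) finR finR1 by (simp add: card_Diff_subset card_mono)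
    then show "card R = card (k ` D) + card (h ` R1)"
      using G.indep_family_inj_on[OF ind] H.indep_family_inj_on[OF R1(2)] by (simp add: card_image)
  qed
qed

text \<open>Rank is defined for subsets of a fixed group rather than for subgroups as groups in their
  own right: kernels and images in an exact sequence are then literally equal sets with equal
  rank, and no change of carrier is needed.\<close>

definition rank_in :: "('a, 'b) monoid_scheme \<Rightarrow> 'a set \<Rightarrow> nat" where
  "rank_in G K = Sup {card S | S. S \<subseteq> K \<and> int_independent G S}"

text \<open>A bound on independent subsets; without it the supremum in \<open>rank_in\<close> carries no information.\<close>

definition finite_rank_in :: "('a, 'b) monoid_scheme \<Rightarrow> 'a set \<Rightarrow> bool" where
  "finite_rank_in G K \<longleftrightarrow> (\<exists>n. \<forall>S. S \<subseteq> K \<longrightarrow> int_independent G S \<longrightarrow> card S \<le> n)"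

lemma abelian_rank_eq: "abelian_rank G = rank_in G (carrier G)"
  unfolding abelian_rank_def rank_in_def int_independent_def by (rule arg_cong[of _ _ Sup]) auto

lemma finite_rank_in_mono:
  assumes "finite_rank_in G K'" "K \<subseteq> K'"
  shows "finite_rank_in G K"
  using assms unfolding finite_rank_in_def by (meson order_trans)

lemma card_le_rank_in:
  assumes "finite_rank_in G K" "S \<subseteq> K" "int_independent G S"
  shows "card S \<le> rank_in G K"
  unfolding rank_in_def
proof (rule cSup_upper)
  show "bdd_above {card S |S. S \<subseteq> K \<and> int_independent G S}"
    using assms(1) by (auto simp: finite_rank_in_def bdd_above_def)
qed (use assms in auto)

lemma rank_in_witness:
  assumes "finite_rank_in G K"
  obtains S where "S \<subseteq> K" "int_independent G S" "card S = rank_in G K"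
proof -
  let ?A = "{card S |S. S \<subseteq> K \<and> int_independent G S}"
  have zero: "0 \<in> ?A" by (rule CollectI, rule exI[of _ "{}"]) (simp add: int_independent_def)
  have "bdd_above ?A"
    using assms by (auto simp: finite_rank_in_def bdd_above_def)
  then have "finite ?A" by (simp add: bdd_above_nat)
  moreover from this and zero have "Max ?A \<in> ?A" by (intro Max_in) auto
  ultimately have "Sup ?A \<in> ?A" by (metis (no_types, lifting) Sup_nat_def empty_iff)
  with that show ?thesis by (auto simp: rank_in_def)
qed

lemma rank_in_eqI:
  assumes "S \<subseteq> K" "int_independent G S" "\<And>S. S \<subseteq> K \<Longrightarrow> int_independent G S \<Longrightarrow> card S \<le> n" "card S = n"
  shows "finite_rank_in G K" "rank_in G K = n"
proof -
  show *: "finite_rank_in G K" using assms by (auto simp: finite_rank_in_def)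
  show "rank_in G K = n"
  proof (rule antisym)
    show "rank_in G K \<le> n" using rank_in_witness[OF *] assms(3) by metis
    show "n \<le> rank_in G K" using card_le_rank_in[OF * assms(1,2)] assms(4) by simp
  qed
qed

lemma rank_in_one: "finite_rank_in G {\<one>\<^bsub>G\<^esub>}" "rank_in G {\<one>\<^bsub>G\<^esub>} = 0" if "comm_group G"
proof -
  interpret comm_group G by fact
  have "S = {}" if S: "S \<subseteq> {\<one>\<^bsub>G\<^esub>}" "int_independent G S" for S
  proof (rule ccontr)
    assume "S \<noteq> {}"
    then have "S = {\<one>\<^bsub>G\<^esub>}" using S by auto
    moreover have "(\<Otimes>\<^bsub>G\<^esub>s\<in>{\<one>\<^bsub>G\<^esub>}. s [^]\<^bsub>G\<^esub> (1 :: int)) = \<one>\<^bsub>G\<^esub>" by simp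
    ultimately show False using int_independentD[OF S(2), of "\<lambda>_. 1" "\<one>\<^bsub>G\<^esub>"] by simp
  qed
  then show "finite_rank_in G {\<one>\<^bsub>G\<^esub>}" "rank_in G {\<one>\<^bsub>G\<^esub>} = 0"
    using rank_in_eqI[of "{}" "{\<one>\<^bsub>G\<^esub>}" G 0] by (auto simp: int_independent_def)
qed

context comm_group_hom begin

lemma int_independent_lift_image:
  assumes "S \<subseteq> kernel G H h" "int_independent G S" "T \<subseteq> h ` carrier G" "int_independent H T"
  obtains R where "R \<subseteq> carrier G" "int_independent G R" "card R = card S + card T"
proof -
  obtain g where g: "\<And>t. t \<in> T \<Longrightarrow> g t \<in> carrier G \<and> h (g t) = t"
  proof -
    have "\<forall>t\<in>T. \<exists>x. x \<in> carrier G \<and> h x = t" using assms(3) by auto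
    then have "\<exists>g. \<forall>t\<in>T. g t \<in> carrier G \<and> h (g t) = t" by (rule bchoice)
    then show ?thesis using that by blast
  qed
  have inj: "inj_on g T" by (rule inj_on_inverseI[of _ h]) (use g in auto)
  have fT: "finite T" "T \<subseteq> carrier H" using assms(4) by (auto simp: int_independent_def)
  then have TH: "t \<in> T \<Longrightarrow> t \<in> carrier H" for t by blast
  then have hg: "h \<in> g ` T \<rightarrow> carrier H" using g by auto
  have gT: "indep_family H (g ` T) h"
    unfolding indep_family_def
  proof (intro conjI allI impI ballI hg)
    show "finite (g ` T)" using fT by simp
    fix c :: "_ \<Rightarrow> int" and i assume eq: "(\<Otimes>\<^bsub>H\<^esub>i\<in>g ` T. h i [^]\<^bsub>H\<^esub> c i) = \<one>\<^bsub>H\<^esub>" and i: "i \<in> g ` T"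
    have "(\<Otimes>\<^bsub>H\<^esub>i\<in>g ` T. h i [^]\<^bsub>H\<^esub> c i) = (\<Otimes>\<^bsub>H\<^esub>t\<in>T. h (g t) [^]\<^bsub>H\<^esub> c (g t))"
      using g TH by (intro H.finprod_reindex inj) auto
    also have "\<dots> = (\<Otimes>\<^bsub>H\<^esub>t\<in>T. t [^]\<^bsub>H\<^esub> c (g t))"
      by (intro H.finprod_cong' Pi_I H.int_pow_closed TH) (use g in auto)
    finally have prod: "(\<Otimes>\<^bsub>H\<^esub>t\<in>T. t [^]\<^bsub>H\<^esub> c (g t)) = \<one>\<^bsub>H\<^esub>" using eq by simp
    from i obtain t where t: "t \<in> T" "i = g t" by auto
    show "c i = 0"
      unfolding t(2) by (rule int_independentD[OF assms(4) prod t(1)])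
  qed
  have "g ` T \<subseteq> carrier G" using g by auto
  note * = int_independent_Un_lift[OF assms(1,2) this gT]
  show ?thesis
  proof
    show "S \<union> g ` T \<subseteq> carrier G" using *(1) by (simp add: int_independent_def)
    show "card (S \<union> g ` T) = card S + card T"
      using * fT by (subst card_Un_disjoint) (auto simp: card_image[OF inj] int_independent_def)
  qed fact
qed

text \<open>Independent subsets of kernel and image lift to an independent subset of \<open>G\<close>, and conversely
  an independent subset of \<open>G\<close> splits into two such parts.\<close>

theorem rank_nullity:
  shows "finite_rank_in G (carrier G) \<longleftrightarrow> finite_rank_in G (kernel G H h) \<and> finite_rank_in H (h ` carrier G)"
      (is "?L \<longleftrightarrow> ?K \<and> ?I")
    and "finite_rank_in G (carrier G) \<Longrightarrow>
      rank_in G (carrier G) = rank_in G (kernel G H h) + rank_in H (h ` carrier G)"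
proof -
  have "?K" if ?L
    using that by (rule finite_rank_in_mono) (auto simp: kernel_def)
  moreover have "?I" if ?L
  proof -
    have "int_independent G {}" by (simp add: int_independent_def)
    then have "card T \<le> rank_in G (carrier G)" if T: "T \<subseteq> h ` carrier G" "int_independent H T" for T
    proof -
      obtain R where "R \<subseteq> carrier G" "int_independent G R" "card R = card T"
        by (rule int_independent_lift_image[OF empty_subsetI \<open>int_independent G {}\<close> T]) auto
      then show ?thesis using card_le_rank_in[OF \<open>?L\<close>, of R] by simp
    qed
    then show ?I by (auto simp: finite_rank_in_def)
  qed
  moreover have up: "card R \<le> rank_in G (kernel G H h) + rank_in H (h ` carrier G)"
    if "?K" "?I" "int_independent G R" for R
  proof -
    obtain S T where "S \<subseteq> kernel G H h" "int_independent G S"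
      "T \<subseteq> h ` carrier G" "int_independent H T" "card R = card S + card T"
      using int_independent_split[OF \<open>int_independent G R\<close>] .
    then show ?thesis
      using card_le_rank_in[OF \<open>?K\<close>, of S] card_le_rank_in[OF \<open>?I\<close>, of T] by simp
  qed
  then have "?L" if "?K" "?I"
    using that by (auto simp: finite_rank_in_def)
  ultimately show iff: "?L \<longleftrightarrow> ?K \<and> ?I" by blast
  assume L: ?L
  obtain S where S: "S \<subseteq> kernel G H h" "int_independent G S" "card S = rank_in G (kernel G H h)"
    using iff L rank_in_witness by metis
  obtain T where T: "T \<subseteq> h ` carrier G" "int_independent H T" "card T = rank_in H (h ` carrier G)"
    using iff L rank_in_witness by metis
  obtain R where R: "R \<subseteq> carrier G" "int_independent G R" "card R = card S + card T"
    using int_independent_lift_image[OF S(1,2) T(1,2)] .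
  show "rank_in G (carrier G) = rank_in G (kernel G H h) + rank_in H (h ` carrier G)"
    by (rule rank_in_eqI(2)[OF R(1,2)]) (use S T R iff L up in auto)
qed

end

lemma iso_rank:
  assumes "comm_group G" "comm_group H" "G \<cong> H"
  shows "finite_rank_in H (carrier H) \<longleftrightarrow> finite_rank_in G (carrier G)"
    and "finite_rank_in G (carrier G) \<Longrightarrow> rank_in H (carrier H) = rank_in G (carrier G)"
proof -
  obtain f where f: "f \<in> iso G H" using assms(3) by (auto simp: is_iso_def)
  interpret comm_group_hom G H f
    using assms(1,2) f
    by (intro comm_group_hom.intro group_hom.intro group_hom_axioms.intro)
       (auto simp: comm_group_def iso_def)
  have "inj_on f (carrier G)" "f ` carrier G = carrier H"
    using f by (auto simp: iso_def bij_betw_def)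
  moreover from this have "kernel G H f = {\<one>\<^bsub>G\<^esub>}" using inj_iff_trivial_ker by auto
  ultimately show "finite_rank_in H (carrier H) \<longleftrightarrow> finite_rank_in G (carrier G)"
    and "finite_rank_in G (carrier G) \<Longrightarrow> rank_in H (carrier H) = rank_in G (carrier G)"
    using rank_nullity rank_in_one[OF assms(1)] by auto
qed

text \<open>Two distinct integers \<open>x\<close>, \<open>y\<close> satisfy the relation \<open>y x - x y = 0\<close>.\<close>

lemma rank_integer_group:
  "finite_rank_in integer_group (carrier integer_group)" "rank_in integer_group (carrier integer_group) = 1"
proof -
  interpret comm_group integer_group by (rule abelian_integer_group)
  have "int_independent integer_group {1}"
    by (simp add: int_independent_def)
  moreover have "card S \<le> 1" if S: "int_independent integer_group S" for S
  proof (rule ccontr)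
    assume "\<not> card S \<le> 1"
    then obtain x y where xy: "x \<in> S" "y \<in> S" "x \<noteq> y"
      by (metis One_nat_def card_le_Suc0_iff_eq int_independent_def S)
    define c where "c = (\<lambda>k. if k = x then y else if k = y then - x else 0)"
    have "(\<Otimes>\<^bsub>integer_group\<^esub>k\<in>S. k [^]\<^bsub>integer_group\<^esub> c k) = (\<Otimes>\<^bsub>integer_group\<^esub>k\<in>{x,y}. k [^]\<^bsub>integer_group\<^esub> c k)"
      using xy S by (intro finprod_mono_neutral_cong_right) (auto simp: c_def int_independent_def)
    also have "\<dots> = 0" using xy by (simp add: c_def)
    finally have "c x = 0" "c y = 0" using S xy by (auto simp: int_independent_def)
    then show False using xy by (auto simp: c_def split: if_splits)
  qed
  ultimately show "finite_rank_in integer_group (carrier integer_group)" "rank_in integer_group (carrier integer_group) = 1"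
    using rank_in_eqI[of "{1}" "carrier integer_group" integer_group 1] by auto
qed

section \<open>Euler characteristics of pairs of spaces\<close>

abbreviation rel_rank :: "nat \<Rightarrow> 'a topology \<Rightarrow> 'a set \<Rightarrow> nat" where
  "rel_rank p X S \<equiv> rank_in (relative_homology_group (int p) X S) (carrier (relative_homology_group (int p) X S))"

abbreviation rel_finite_rank :: "nat \<Rightarrow> 'a topology \<Rightarrow> 'a set \<Rightarrow> bool" where
  "rel_finite_rank p X S \<equiv> finite_rank_in (relative_homology_group (int p) X S) (carrier (relative_homology_group (int p) X S))"

text \<open>A predicate instead of a function, because finiteness of all ranks and their vanishing in high
  degrees have to travel with the value: only then is the alternating sum additive. Partial
  sums make the telescoping along a long exact sequence direct.\<close>

definition has_rel_euler :: "'a topology \<Rightarrow> 'a set \<Rightarrow> int \<Rightarrow> bool" where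
  "has_rel_euler X S e \<longleftrightarrow> (\<forall>p. rel_finite_rank p X S) \<and>
     (\<exists>N. \<forall>n\<ge>N. rel_rank n X S = 0 \<and> (\<Sum>p<n. (-1) ^ p * int (rel_rank p X S)) = e)"

lemma has_rel_eulerI:
  assumes "\<And>p. rel_finite_rank p X S" "\<And>p. p \<ge> N \<Longrightarrow> rel_rank p X S = 0"
    "(\<Sum>p<N. (-1) ^ p * int (rel_rank p X S)) = e"
  shows "has_rel_euler X S e"
  unfolding has_rel_euler_def
proof (intro conjI exI allI impI)
  fix n assume n: "n \<ge> N"
  have "(\<Sum>p<n. (-1) ^ p * int (rel_rank p X S)) = (\<Sum>p<N. (-1) ^ p * int (rel_rank p X S))"
    using n assms(2) by (intro sum.mono_neutral_right) auto
  then show "(\<Sum>p<n. (-1) ^ p * int (rel_rank p X S)) = e" using assms(3) by simp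
qed (use assms in auto)

lemma has_rel_euler_imp_euler_characteristic:
  assumes "has_rel_euler X {} e"
  shows "euler_characteristic X = e"
proof -
  obtain N where N: "\<And>n. n \<ge> N \<Longrightarrow> rel_rank n X {} = 0 \<and> (\<Sum>p<n. (-1) ^ p * int (rel_rank p X {})) = e"
    using assms by (auto simp: has_rel_euler_def)
  have b: "betti_number p X = rel_rank p X {}" for p
    by (simp add: betti_number_def abelian_rank_eq)
  have small: "p < N" if "rel_rank p X {} \<noteq> 0" for p
    using N[of p] that by (metis not_le)
  have "euler_characteristic X = (\<Sum>p<N. (-1) ^ p * int (rel_rank p X {}))"
    unfolding euler_characteristic_def b
    using small by (intro sum.mono_neutral_left) auto
  then show ?thesis using N[of N] by simp
qed

lemma has_rel_euler_iso:
  assumes "has_rel_euler X S e" "\<And>p. relative_homology_group p X S \<cong> relative_homology_group p Y T"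
  shows "has_rel_euler Y T e"
proof -
  note iso = iso_rank[OF abelian_relative_homology_group abelian_relative_homology_group assms(2)]
  have f: "rel_finite_rank p X S" for p using assms(1) by (auto simp: has_rel_euler_def)
  have "rel_finite_rank p Y T \<and> rel_rank p Y T = rel_rank p X S" for p
    using iso f by simp
  then show ?thesis using assms(1) by (simp add: has_rel_euler_def)
qed

lemma has_rel_euler_homotopy:
  "has_rel_euler X {} e \<Longrightarrow> X homotopy_equivalent_space Y \<Longrightarrow> has_rel_euler Y {} e"
  by (rule has_rel_euler_iso) (auto intro: homotopy_equivalent_space_imp_isomorphic_homology_groups)

lemma trivial_group_rank:
  assumes "trivial_group G" "comm_group G"
  shows "finite_rank_in G (carrier G)" "rank_in G (carrier G) = 0"
  using rank_in_one[OF assms(2)] assms(1) by (auto simp: trivial_group_def)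

lemma has_rel_euler_empty:
  assumes "topspace X = {}"
  shows "has_rel_euler X {} 0"
  by (rule has_rel_eulerI[of _ _ 0])
    (auto intro: trivial_group_rank trivial_homology_group_empty[OF assms])

lemma has_rel_euler_singleton:
  assumes "topspace X = {a}"
  shows "has_rel_euler X {} 1"
proof (rule has_rel_eulerI[of _ _ 1])
  have iso: "integer_group \<cong> homology_group 0 X"
    using homology_coefficients[OF assms] by (intro group.iso_sym[of "homology_group 0 X"]) auto
  note r0 = iso_rank[OF abelian_integer_group abelian_relative_homology_group iso]
  have triv: "rel_finite_rank p X {}" "rel_rank p X {} = 0" if "p \<noteq> 0" for p
    using trivial_group_rank[OF homology_dimension_axiom[OF assms]] that by auto
  show "rel_finite_rank p X {}" for p
    using triv[of p] r0 rank_integer_group by (cases "p = 0") auto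
  show "rel_rank p X {} = 0" if "p \<ge> 1" for p using triv that by auto
  show "(\<Sum>p<1. (- 1) ^ p * int (rel_rank p X {})) = 1" using r0 rank_integer_group by simp
qed

text \<open>Here \<open>a\<close>, \<open>x\<close>, \<open>r\<close> are the ranks of the three families of groups in a long exact sequence and
  \<open>i\<close>, \<open>j\<close>, \<open>d\<close> the ranks of its maps, \<open>d\<close> belonging to the connecting map out of degree \<open>p\<close>.
  Truncating in degree \<open>n\<close> leaves the single boundary term \<open>d n\<close>.\<close>

lemma alternating_sum_exact:
  fixes a x r d i j :: "nat \<Rightarrow> nat"
  assumes "\<And>p. a p = d (Suc p) + i p" "\<And>p. x p = i p + j p" "\<And>p. r p = j p + d p" "d 0 = 0"
  shows "(\<Sum>p<n. (-1) ^ p * int (x p)) = (\<Sum>p<n. (-1) ^ p * int (a p)) + (\<Sum>p<n. (-1) ^ p * int (r p)) + (-1) ^ n * int (d n)"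
  by (induction n) (auto simp: assms algebra_simps)

lemma comm_group_hom_homology:
  assumes "h \<in> hom (relative_homology_group p X S) (relative_homology_group q Y T)"
  shows "comm_group_hom (relative_homology_group p X S) (relative_homology_group q Y T) h"
proof -
  have "comm_group (relative_homology_group p X S)" "comm_group (relative_homology_group q Y T)" by auto
  then show ?thesis
    using assms by (intro comm_group_hom.intro group_hom.intro group_hom_axioms.intro) (auto simp: comm_group_def)
qed

text \<open>Rank-nullity for the three maps of the long exact sequence of a pair. The boolean functions
  record finiteness of the ranks of the same images; the connecting map out of degree 0
  has a trivial target.\<close>

lemma long_exact_ranks:
  fixes X :: "'a topology" and S :: "'a set"
  defines "A \<equiv> subtopology X S"
  obtains d i j fd fi fj where
    "\<And>p. rel_finite_rank p A {} \<longleftrightarrow> fd (Suc p) \<and> fi p"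
    "\<And>p. rel_finite_rank p X {} \<longleftrightarrow> fi p \<and> fj p"
    "\<And>p. rel_finite_rank p X S \<longleftrightarrow> fj p \<and> fd p"
    "\<And>p. rel_finite_rank p A {} \<Longrightarrow> rel_rank p A {} = d (Suc p) + i p"
    "\<And>p. rel_finite_rank p X {} \<Longrightarrow> rel_rank p X {} = i p + j p"
    "\<And>p. rel_finite_rank p X S \<Longrightarrow> rel_rank p X S = j p + d p"
    "d 0 = (0::nat)" "fd 0"
proof -
  let ?A = "\<lambda>p. homology_group p A" and ?X = "\<lambda>p. homology_group p X" and ?R = "\<lambda>p. relative_homology_group p X S"
  let ?d = "\<lambda>p. hom_boundary p X S"
  let ?i = "\<lambda>p. hom_induced p A {} X {} id"
  let ?j = "\<lambda>p. hom_induced p X {} X S id"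
  define fd d where "fd p = finite_rank_in (?A (int p - 1)) (?d (int p) ` carrier (?R (int p)))"
    and "d p = rank_in (?A (int p - 1)) (?d (int p) ` carrier (?R (int p)))" for p
  define fi i where "fi p = finite_rank_in (?X (int p)) (?i (int p) ` carrier (?A (int p)))"
    and "i p = rank_in (?X (int p)) (?i (int p) ` carrier (?A (int p)))" for p
  define fj j where "fj p = finite_rank_in (?R (int p)) (?j (int p) ` carrier (?X (int p)))"
    and "j p = rank_in (?R (int p)) (?j (int p) ` carrier (?X (int p)))" for p
  have kd: "kernel (?R p) (?A (p - 1)) (?d p) = ?j p ` carrier (?X p)" for p
    using homology_exactness_axiom_1[of p X S] unfolding A_def by simp
  have ki: "kernel (?A p) (?X p) (?i p) = ?d (p + 1) ` carrier (?R (p + 1))" for p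
    using homology_exactness_axiom_2[of "p + 1" X S] unfolding A_def by simp
  have kj: "kernel (?X p) (?R p) (?j p) = ?i p ` carrier (?A p)" for p
    using homology_exactness_axiom_3[of p X S] unfolding A_def by simp
  have hd: "comm_group_hom (?R p) (?A (p - 1)) (?d p)" for p
    unfolding A_def by (intro comm_group_hom_homology hom_boundary_hom)
  have hi: "comm_group_hom (?A p) (?X p) (?i p)" for p
    by (intro comm_group_hom_homology hom_induced_hom)
  have hj: "comm_group_hom (?X p) (?R p) (?j p)" for p
    by (intro comm_group_hom_homology hom_induced_hom)
  note rn = comm_group_hom.rank_nullity
  have "?d 0 ` carrier (?R 0) = {\<one>\<^bsub>?A (- 1)\<^esub>}"
  proof -
    interpret comm_group_hom "?R 0" "?A (- 1)" "?d 0" using hd[of 0] by simp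
    have "carrier (?A (- 1)) = {\<one>\<^bsub>?A (- 1)\<^esub>}"
      using trivial_homology_group[of "-1" A] by (auto simp: trivial_group_def)
    moreover have "?d 0 ` carrier (?R 0) \<subseteq> carrier (?A (- 1))" by (rule image_subsetI) (rule hom_closed)
    moreover have "?d 0 ` carrier (?R 0) \<noteq> {}" using G.one_closed by blast
    ultimately show ?thesis by blast
  qed
  then have z: "fd 0" "d 0 = 0"
    using rank_in_one[of "?A (- 1)"] by (auto simp: fd_def d_def)
  show ?thesis
  proof
    show "rel_finite_rank p A {} \<longleftrightarrow> fd (Suc p) \<and> fi p" for p
      using rn(1)[OF hi[of "int p"]] by (simp add: fd_def fi_def ki add.commute)
    show "rel_finite_rank p X {} \<longleftrightarrow> fi p \<and> fj p" for p
      using rn(1)[OF hj[of "int p"]] by (simp add: fj_def fi_def kj)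
    show "rel_finite_rank p X S \<longleftrightarrow> fj p \<and> fd p" for p
      using rn(1)[OF hd[of "int p"]] by (simp add: fj_def fd_def kd)
    show "rel_rank p A {} = d (Suc p) + i p" if "rel_finite_rank p A {}" for p
      using rn(2)[OF hi[of "int p"] that] by (simp add: d_def i_def ki add.commute)
    show "rel_rank p X {} = i p + j p" if "rel_finite_rank p X {}" for p
      using rn(2)[OF hj[of "int p"] that] by (simp add: j_def i_def kj)
    show "rel_rank p X S = j p + d p" if "rel_finite_rank p X S" for p
      using rn(2)[OF hd[of "int p"] that] by (simp add: j_def d_def kd)
  qed (use z in auto)
qed

text \<open>Additivity along the long exact sequence, in both directions in which it is needed: from
  the absolute groups to the relative ones and back.\<close>

lemma has_rel_euler_pair:
  assumes A: "has_rel_euler (subtopology X S) {} a"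
  shows has_rel_euler_pair_relative: "has_rel_euler X {} x \<Longrightarrow> has_rel_euler X S (x - a)"
    and has_rel_euler_pair_absolute: "has_rel_euler X S r \<Longrightarrow> has_rel_euler X {} (a + r)"
proof -
  let ?A = "subtopology X S"
  obtain d i j fd fi fj where *:
    "\<And>p. rel_finite_rank p ?A {} \<longleftrightarrow> fd (Suc p) \<and> fi p"
    "\<And>p. rel_finite_rank p X {} \<longleftrightarrow> fi p \<and> fj p"
    "\<And>p. rel_finite_rank p X S \<longleftrightarrow> fj p \<and> fd p"
    and ra: "\<And>p. rel_finite_rank p ?A {} \<Longrightarrow> rel_rank p ?A {} = d (Suc p) + i p"
    and rx: "\<And>p. rel_finite_rank p X {} \<Longrightarrow> rel_rank p X {} = i p + j p"
    and rr: "\<And>p. rel_finite_rank p X S \<Longrightarrow> rel_rank p X S = j p + d p"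
    and d0: "d 0 = 0" and fd0: "fd 0"
    by (rule long_exact_ranks[of X S]) (rule that)
  have fd: "fd p" for p
    using *(1) A fd0 by (cases p) (auto simp: has_rel_euler_def)
  have fA: "rel_finite_rank p ?A {}" for p using A by (auto simp: has_rel_euler_def)
  obtain N where N: "\<And>n. n \<ge> N \<Longrightarrow> rel_rank n ?A {} = 0 \<and> (\<Sum>p<n. (-1) ^ p * int (rel_rank p ?A {})) = a"
    using A by (auto simp: has_rel_euler_def)
  have sum: "(\<Sum>p<n. (-1) ^ p * int (rel_rank p X {})) = a + (\<Sum>p<n. (-1) ^ p * int (rel_rank p X S))"
    if "n \<ge> Suc N" "\<And>p. rel_finite_rank p X {}" "\<And>p. rel_finite_rank p X S" for n
  proof -
    \<comment> \<open>The connecting map out of degree n lands in degree n - 1, where the subspace has rank 0.\<close>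
    have "d n = 0" using ra[OF fA, of "n - 1"] N[of "n - 1"] that(1) by simp
    then show ?thesis
      using alternating_sum_exact[of "\<lambda>p. rel_rank p ?A {}" d i "\<lambda>p. rel_rank p X {}" j "\<lambda>p. rel_rank p X S" n,
          OF ra[OF fA] rx[OF that(2)] rr[OF that(3)] d0] N[of n] that(1) by simp
  qed
  show "has_rel_euler X S (x - a)" if X: "has_rel_euler X {} x"
  proof -
    have fX: "rel_finite_rank p X {}" for p using X by (auto simp: has_rel_euler_def)
    have fR: "rel_finite_rank p X S" for p using * fX fd by metis
    obtain M where M: "\<And>n. n \<ge> M \<Longrightarrow> rel_rank n X {} = 0 \<and> (\<Sum>p<n. (-1) ^ p * int (rel_rank p X {})) = x"
      using X by (auto simp: has_rel_euler_def)
    show ?thesis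
    proof (rule has_rel_eulerI[of _ _ "max M (Suc N)"])
      show "rel_rank p X S = 0" if "p \<ge> max M (Suc N)" for p
        using ra[OF fA, of "p - 1"] N[of "p - 1"] rr[OF fR, of p] rx[OF fX, of p] M[of p] that by simp
      show "(\<Sum>p<max M (Suc N). (-1) ^ p * int (rel_rank p X S)) = x - a"
        using sum[OF _ fX fR, of "max M (Suc N)"] M[of "max M (Suc N)"] by simp
    qed (rule fR)
  qed
  show "has_rel_euler X {} (a + r)" if R: "has_rel_euler X S r"
  proof -
    have fR: "rel_finite_rank p X S" for p using R by (auto simp: has_rel_euler_def)
    have fX: "rel_finite_rank p X {}" for p using * fR fA by metis
    obtain M where M: "\<And>n. n \<ge> M \<Longrightarrow> rel_rank n X S = 0 \<and> (\<Sum>p<n. (-1) ^ p * int (rel_rank p X S)) = r"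
      using R by (auto simp: has_rel_euler_def)
    show ?thesis
    proof (rule has_rel_eulerI[of _ _ "max M (Suc N)"])
      show "rel_rank p X {} = 0" if "p \<ge> max M (Suc N)" for p
        using ra[OF fA, of p] N[of p] rr[OF fR, of p] rx[OF fX, of p] M[of p] that by simp
      show "(\<Sum>p<max M (Suc N). (-1) ^ p * int (rel_rank p X {})) = a + r"
        using sum[OF _ fX fR, of "max M (Suc N)"] M[of "max M (Suc N)"] by simp
    qed (rule fX)
  qed
qed

text \<open>Excision identifies the homology of \<open>(X, U)\<close> with that of \<open>(W, U \<inter> W)\<close>: the excised set
  \<open>C\<close> is the complement of \<open>W\<close>, which is closed and contained in the open set \<open>U\<close>.\<close>

theorem has_rel_euler_Un:
  assumes U: "openin X U" and W: "openin X W" and cover: "U \<union> W = topspace X"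
    and u: "has_rel_euler (subtopology X U) {} u"
    and w: "has_rel_euler (subtopology X W) {} w"
    and v: "has_rel_euler (subtopology X (U \<inter> W)) {} v"
  shows "has_rel_euler X {} (u + w - v)"
proof -
  have sub: "U \<subseteq> topspace X" "W \<subseteq> topspace X" using U W openin_subset by auto
  define C where "C = topspace X - W"
  have [simp]: "topspace X - C = W" "U - C = U \<inter> W" using sub by (auto simp: C_def)
  have "has_rel_euler (subtopology X W) (U \<inter> W) (w - v)"
  proof (rule has_rel_euler_pair_relative[OF _ w])
    show "has_rel_euler (subtopology (subtopology X W) (U \<inter> W)) {} v"
      using v by (simp add: subtopology_subtopology inf_commute inf_left_commute)
  qed
  moreover have "closedin X C" using W by (simp add: C_def closedin_diff)
  then have "X closure_of C \<subseteq> X interior_of U"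
    using U cover by (auto simp: closure_of_closedin interior_of_openin C_def)
  from homology_excision_axiom[OF this sub(1)]
  have "relative_homology_group p (subtopology X W) (U \<inter> W) \<cong> relative_homology_group p X U" for p
    by (auto simp: is_iso_def)
  ultimately have "has_rel_euler X U (w - v)" by (rule has_rel_euler_iso)
  from has_rel_euler_pair_absolute[OF u this] show ?thesis by (simp add: algebra_simps)
qed

section \<open>Slabs of a polyhedral product\<close>

definition down_closed :: "'v set set \<Rightarrow> bool" where
  "down_closed K \<longleftrightarrow> (\<forall>\<sigma>\<in>K. \<forall>\<tau>. \<tau> \<subseteq> \<sigma> \<longrightarrow> \<tau> \<in> K)"

lemma topspace_polyhedral_product:
  "topspace (polyhedral_product I K A B) = {x \<in> (\<Pi>\<^sub>E i\<in>I. topspace (A i)). point_support I B x \<in> K}"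
  by (auto simp: polyhedral_product_def)

lemma continuous_map_polyhedral_product_projection:
  "k \<in> I \<Longrightarrow> continuous_map (polyhedral_product I K A B) (A k) (\<lambda>x. x k)"
  unfolding polyhedral_product_def
  by (intro continuous_map_from_subtopology continuous_map_product_projection)

lemma continuous_map_into_polyhedral_product:
  assumes "\<And>i. i \<in> I \<Longrightarrow> continuous_map X (A i) (\<lambda>x. f x i)"
    and "\<And>x. x \<in> topspace X \<Longrightarrow> f x \<in> extensional I"
    and "\<And>x. x \<in> topspace X \<Longrightarrow> point_support I B (f x) \<in> K"
  shows "continuous_map X (polyhedral_product I K A B) f"
  unfolding polyhedral_product_def continuous_map_in_subtopology continuous_map_componentwise
  using assms by auto

text \<open>The slab over \<open>T\<close> is the part of the polyhedral product whose coordinate \<open>m\<close> lies in \<open>T\<close>. A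
  contraction of \<open>T\<close> to \<open>c\<close> that never leaves the subspace \<open>B m\<close> can only shrink supports, so it
  acts on the slab and retracts it to the slice where coordinate \<open>m\<close> is \<open>c\<close>. That slice is a
  polyhedral product over the remaining indices: if \<open>c\<close> is a base point, \<open>m\<close> is never in the
  support and the simplices are those of \<open>K\<close> avoiding \<open>m\<close> (the deletion of \<open>m\<close>); otherwise \<open>m\<close> is
  always in the support and the simplices form the link of \<open>m\<close>. The link may miss
  vertices or be empty, so the recursion runs over families closed under subsets.\<close>

lemma polyhedral_product_slab_homotopy_equivalent:
  fixes A :: "'i \<Rightarrow> 'a topology"
  assumes m: "m \<notin> I" and K: "down_closed K"
    and T: "T \<subseteq> topspace (A m)" and c: "c \<in> T"
    and cont: "continuous_map (prod_topology (top_of_set {0..1}) (subtopology (A m) T)) (subtopology (A m) T) k"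
    and k0: "\<And>y. y \<in> T \<Longrightarrow> k (0, y) = y" and k1: "\<And>y. y \<in> T \<Longrightarrow> k (1::real, y) = c"
    and kB: "\<And>t y. t \<in> {0..1} \<Longrightarrow> y \<in> T \<Longrightarrow> y \<in> B m \<Longrightarrow> k (t, y) \<in> B m"
  shows "subtopology (polyhedral_product (insert m I) K A B) {x. x m \<in> T} homotopy_equivalent_space
    polyhedral_product I {J. J \<subseteq> I \<and> (if c \<in> B m then J else insert m J) \<in> K} A B"
    (is "?Y homotopy_equivalent_space ?Z")
proof -
  have topY: "topspace ?Y = {x \<in> (\<Pi>\<^sub>E i\<in>insert m I. topspace (A i)). point_support (insert m I) B x \<in> K \<and> x m \<in> T}"
    by (auto simp: topspace_polyhedral_product)
  have sub: "\<tau> \<in> K" if "\<sigma> \<in> K" "\<tau> \<subseteq> \<sigma>" for \<sigma> \<tau>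
    using K that by (auto simp: down_closed_def)
  have kT: "k (t, y) \<in> T" if "t \<in> {0..1}" "y \<in> T" for t y
  proof -
    have "(t, y) \<in> topspace (prod_topology (top_of_set {0..1}) (subtopology (A m) T))"
      using that T by auto
    then have "k (t, y) \<in> topspace (subtopology (A m) T)"
      using continuous_map_image_subset_topspace[OF cont] by blast
    then show ?thesis by simp
  qed
  \<comment> \<open>A base point of T moves within the base to c; so if c is not a base point, m lies in every support.\<close>
  have cB: "c \<in> B m" if "y \<in> T" "y \<in> B m" for y
    using kB[of 1 y] k1 that by auto
  define r where "r = (\<lambda>x :: 'i \<Rightarrow> 'a. restrict x I)"
  define s where "s = (\<lambda>x :: 'i \<Rightarrow> 'a. x(m := c))"
  define h where "h = (\<lambda>(t :: real, x :: 'i \<Rightarrow> 'a). x(m := k (t, x m)))"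
  have projY: "continuous_map ?Y (A i) (\<lambda>x. x i)" if "i \<in> insert m I" for i
    using that by (intro continuous_map_from_subtopology continuous_map_polyhedral_product_projection)
  have cr: "continuous_map ?Y ?Z r"
  proof (rule continuous_map_into_polyhedral_product)
    show "continuous_map ?Y (A i) (\<lambda>x. r x i)" if "i \<in> I" for i
      using projY[of i] that by (simp add: r_def)
    show "r x \<in> extensional I" for x by (simp add: r_def)
    fix x assume x: "x \<in> topspace ?Y"
    then have xK: "point_support (insert m I) B x \<in> K" and xT: "x m \<in> T"
      unfolding topY by blast+
    have "point_support I B (r x) = point_support (insert m I) B x - {m}"
      using m by (auto simp: point_support_def r_def)
    moreover have "point_support (insert m I) B x - {m} \<in> K"
      using xK by (rule sub) auto
    moreover have "insert m (point_support (insert m I) B x - {m}) \<in> K" if "c \<notin> B m"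
    proof -
      have "m \<in> point_support (insert m I) B x"
        using xT cB that by (auto simp: point_support_def)
      then show ?thesis using xK by (simp add: insert_absorb)
    qed
    ultimately show "point_support I B (r x) \<in> {J. J \<subseteq> I \<and> (if c \<in> B m then J else insert m J) \<in> K}"
      by (auto simp: point_support_def)
  qed
  have cs: "continuous_map ?Z ?Y s"
  proof (rule continuous_map_into_subtopology)
    show "continuous_map ?Z (polyhedral_product (insert m I) K A B) s"
    proof (rule continuous_map_into_polyhedral_product)
      show "continuous_map ?Z (A i) (\<lambda>x. s x i)" if "i \<in> insert m I" for i
        using that T c m continuous_map_polyhedral_product_projection[of i I _ A B]
        by (cases "i = m") (auto simp: s_def)
      fix x assume x: "x \<in> topspace ?Z"
      show "s x \<in> extensional (insert m I)"
        using x by (auto simp: s_def topspace_polyhedral_product PiE_def extensional_def)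
      have "point_support (insert m I) B (s x) =
          (if c \<in> B m then point_support I B x else insert m (point_support I B x))"
        using m by (auto simp: point_support_def s_def)
      then show "point_support (insert m I) B (s x) \<in> K"
        using x by (auto simp: topspace_polyhedral_product)
    qed
    show "s \<in> topspace ?Z \<rightarrow> {x. x m \<in> T}" using c by (auto simp: s_def)
  qed
  have "homotopic_with (\<lambda>x. True) ?Y ?Y id (s \<circ> r)"
  proof (subst homotopic_with, simp, intro exI[of _ h] conjI ballI)
    let ?P = "prod_topology (top_of_set {0..1::real}) ?Y"
    have fstP: "continuous_map ?P (top_of_set {0..1}) fst" and sndP: "continuous_map ?P ?Y snd"
      by (rule continuous_map_fst continuous_map_snd)+
    have pr: "continuous_map ?P (A i) (\<lambda>p. snd p i)" if "i \<in> insert m I" for i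
      using continuous_map_compose[OF sndP projY[OF that]] by (simp add: o_def)
    have "continuous_map ?P (subtopology (A m) T) (\<lambda>p. snd p m)"
      by (rule continuous_map_into_subtopology[OF pr]) (auto simp: topY)
    from continuous_map_compose[OF continuous_map_pairedI[OF fstP this] cont]
    have km: "continuous_map ?P (A m) (\<lambda>p. k (fst p, snd p m))"
      by (simp add: o_def continuous_map_in_subtopology)
    show "continuous_map ?P ?Y h"
    proof (rule continuous_map_into_subtopology)
      show "continuous_map ?P (polyhedral_product (insert m I) K A B) h"
      proof (rule continuous_map_into_polyhedral_product)
        show "continuous_map ?P (A i) (\<lambda>p. h p i)" if "i \<in> insert m I" for i
          using pr[OF that] km by (cases "i = m") (auto simp: h_def case_prod_beta)
        fix p assume p: "p \<in> topspace ?P"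
        obtain t x where tx: "p = (t, x)" "t \<in> {0..1}" "x \<in> topspace ?Y" using p by auto
        show "h p \<in> extensional (insert m I)"
          using tx(3) by (auto simp: tx(1) h_def topspace_polyhedral_product PiE_def extensional_def)
        have xK: "point_support (insert m I) B x \<in> K" and xT: "x m \<in> T"
          using tx(3) unfolding topY by blast+
        have "point_support (insert m I) B (h p) \<subseteq> point_support (insert m I) B x"
          using tx(1,2) xT kB[of t "x m"] by (auto simp: h_def point_support_def)
        with xK show "point_support (insert m I) B (h p) \<in> K" by (rule sub)
      qed
      show "h \<in> topspace ?P \<rightarrow> {x. x m \<in> T}"
        using kT by (auto simp: h_def topY)
    qed
    fix x assume x: "x \<in> topspace ?Y"
    then have xT: "x m \<in> T" by simp
    show "h (0, x) = id x" using x k0 by (auto simp: h_def topY)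
    show "h (1, x) = (s \<circ> r) x"
      using x xT k1 m
      by (auto simp: h_def s_def r_def topspace_polyhedral_product PiE_def extensional_def fun_eq_iff)
  qed simp
  moreover have "homotopic_with (\<lambda>x. True) ?Z ?Z (r \<circ> s) id"
  proof (rule homotopic_with_equal)
    show "continuous_map ?Z ?Z (r \<circ> s)" by (rule continuous_map_compose[OF cs cr])
    fix x assume "x \<in> topspace ?Z"
    then show "(r \<circ> s) x = id x"
      using m by (auto simp: r_def s_def topspace_polyhedral_product PiE_def extensional_def fun_eq_iff)
  qed auto
  ultimately show ?thesis
    unfolding homotopy_equivalent_space_def using cr cs homotopic_with_symD by blast
qed

section \<open>Cones over sets\<close>

text \<open>The point of the edge over \<open>e\<close>: \<open>s = 0\<close> is the cone vertex and \<open>s = 1\<close> the base point \<open>e\<close>.\<close>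

definition cone_point :: "'a \<Rightarrow> real \<Rightarrow> 'a option \<Rightarrow> real" where
  "cone_point e s = (\<lambda>v. if v = None then 1 - s else if v = Some e then s else 0)"

lemma topspace_cone_space:
  fixes E :: "'a set"
  shows "topspace (cone_space E) = insert (vertex_point None) {cone_point e s | e s. e \<in> E \<and> 0 < s \<and> s \<le> 1}"
    (is "_ = insert ?a ?C")
proof -
  have top: "topspace (cone_space E) =
      {x. (\<forall>v. 0 \<le> x v) \<and> {v. x v \<noteq> 0} \<in> cone_complex E \<and> (\<Sum>v | x v \<noteq> 0. x v) = 1}"
    by (simp add: cone_space_def geometric_realization_def)
  show ?thesis
    unfolding top
  proof (intro equalityI subsetI)
    fix x :: "'a option \<Rightarrow> real"
    assume "x \<in> {x. (\<forall>v. 0 \<le> x v) \<and> {v. x v \<noteq> 0} \<in> cone_complex E \<and> (\<Sum>v | x v \<noteq> 0. x v) = 1}"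
    then have nn: "\<And>v. 0 \<le> x v" and supp: "{v. x v \<noteq> 0} \<in> cone_complex E" and sum: "(\<Sum>v | x v \<noteq> 0. x v) = 1"
      by auto
    from supp consider "{v. x v \<noteq> 0} = {}" | "{v. x v \<noteq> 0} = {None}"
      | e where "e \<in> E" "{v. x v \<noteq> 0} = {Some e}" | e where "e \<in> E" "{v. x v \<noteq> 0} = {None, Some e}"
      by (auto simp: cone_complex_def)
    then show "x \<in> insert ?a ?C"
    proof cases
      case 1
      then show ?thesis using sum by simp
    next
      case 2
      then have "x None = 1" using sum by simp
      moreover have "x v = 0" if "v \<noteq> None" for v using 2 that by blast
      ultimately have "x = ?a" by (auto simp: vertex_point_def)
      then show ?thesis by simp
    next
      case (3 e)
      then have "x (Some e) = 1" using sum by simp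
      moreover have "x v = 0" if "v \<noteq> Some e" for v using 3 that by blast
      ultimately have "x = cone_point e 1" by (auto simp: cone_point_def)
      then show ?thesis using 3 by (intro insertI2 CollectI exI[of _ e] exI[of _ "1::real"]) simp
    next
      case (4 e)
      then have s: "x None + x (Some e) = 1" using sum by simp
      moreover have "x v = 0" if "v \<noteq> None" "v \<noteq> Some e" for v using 4 that by blast
      ultimately have "x = cone_point e (x (Some e))" by (auto simp: cone_point_def)
      moreover have "x (Some e) \<noteq> 0" using 4(2) by blast
      then have "0 < x (Some e)" using nn[of "Some e"] by simp
      moreover have "x (Some e) \<le> 1" using s nn[of None] by simp
      ultimately show ?thesis using 4(1) by blast
    qed
  next
    fix x :: "'a option \<Rightarrow> real"
    assume "x \<in> insert ?a ?C"
    then consider "x = ?a" | e s where "e \<in> E" "0 < s" "s < 1" "x = cone_point e s"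
      | e where "e \<in> E" "x = cone_point e 1" by force
    then show "x \<in> {x. (\<forall>v. 0 \<le> x v) \<and> {v. x v \<noteq> 0} \<in> cone_complex E \<and> (\<Sum>v | x v \<noteq> 0. x v) = 1}"
    proof cases
      case 1
      then have "{v. x v \<noteq> 0} = {None}" by (auto simp: vertex_point_def)
      with 1 show ?thesis by (simp add: cone_complex_def vertex_point_def)
    next
      case (2 e s)
      then have "{v. x v \<noteq> 0} = {None, Some e}" by (auto simp: cone_point_def)
      with 2 show ?thesis by (simp add: cone_complex_def cone_point_def)
    next
      case (3 e)
      then have "{v. x v \<noteq> 0} = {Some e}" by (auto simp: cone_point_def)
      with 3 show ?thesis by (simp add: cone_complex_def cone_point_def)
    qed
  qed
qed

lemma cone_point_0: "cone_point e 0 = vertex_point None"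
  by (auto simp: cone_point_def vertex_point_def)

lemma cone_point_1: "cone_point e 1 = vertex_point (Some e)"
  by (auto simp: cone_point_def vertex_point_def)

lemma cone_point_None [simp]: "cone_point e s None = 1 - s"
  and cone_point_Some [simp]: "cone_point e s (Some e') = (if e' = e then s else 0)"
  by (auto simp: cone_point_def)

lemma vertex_point_apply [simp]: "vertex_point v w = (if w = v then 1 else 0)"
  by (simp add: vertex_point_def)

lemma cone_point_in_cone_space: "e \<in> E \<Longrightarrow> 0 \<le> s \<Longrightarrow> s \<le> 1 \<Longrightarrow> cone_point e s \<in> topspace (cone_space E)"
  by (cases "s = 0") (auto simp: topspace_cone_space cone_point_0)

lemma apex_in_cone_space: "vertex_point None \<in> topspace (cone_space E)"
  by (simp add: topspace_cone_space)

lemma cone_base_iff: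
  assumes "y \<in> topspace (cone_space E)"
  shows "y \<in> cone_base E \<longleftrightarrow> y None = 0"
proof
  assume "y None = 0"
  then obtain e where "e \<in> E" "y = cone_point e 1"
    using assms by (auto simp: topspace_cone_space)
  then show "y \<in> cone_base E" by (auto simp: cone_base_def cone_point_1)
qed (auto simp: cone_base_def)

text \<open>Straight-line motion in barycentric coordinates, starting at \<open>y\<close> and ending at \<open>c\<close>; the time
  comes first so that it can serve as a homotopy.\<close>

definition segment :: "('v \<Rightarrow> real) \<Rightarrow> real \<times> ('v \<Rightarrow> real) \<Rightarrow> 'v \<Rightarrow> real" where
  "segment c = (\<lambda>(t, y) v. (1 - t) * y v + t * c v)"

lemma segment_cone_point: "segment (cone_point e s) (t, cone_point e s') = cone_point e ((1 - t) * s' + t * s)"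
  by (auto simp: segment_def cone_point_def algebra_simps)

lemma continuous_map_segment:
  assumes "\<And>t y. t \<in> {0..1} \<Longrightarrow> y \<in> T \<Longrightarrow> segment c (t, y) \<in> T" "T \<subseteq> topspace (geometric_realization K)"
  shows "continuous_map (prod_topology (top_of_set {0..1}) (subtopology (geometric_realization K) T))
    (subtopology (geometric_realization K) T) (segment c)"
proof -
  let ?R = "geometric_realization K"
  let ?P = "prod_topology (top_of_set {0..1::real}) (subtopology ?R T)"
  have topP: "topspace ?P = {0..1} \<times> T" using assms(2) by auto
  have fstP: "continuous_map ?P euclideanreal fst"
    using continuous_map_fst[of "top_of_set {0..1::real}" "subtopology ?R T"]
    by (simp add: continuous_map_in_subtopology)
  have "continuous_map ?P (subtopology ?R T) snd" by (rule continuous_map_snd)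
  then have "continuous_map ?P (powertop_real UNIV) snd"
    by (simp add: continuous_map_in_subtopology geometric_realization_def)
  then have sndP: "continuous_map ?P euclideanreal (\<lambda>p. snd p v)" for v
    by (simp add: continuous_map_componentwise_UNIV)
  have "continuous_map ?P (powertop_real UNIV) (segment c)"
    unfolding continuous_map_componentwise_UNIV segment_def case_prod_beta
    by (intro allI continuous_intros fstP sndP)
  moreover have "segment c p \<in> T" if "p \<in> topspace ?P" for p
    using assms(1) that unfolding topP by auto
  moreover have "T \<subseteq> {x. (\<forall>v. 0 \<le> x v) \<and> {v. x v \<noteq> 0} \<in> K \<and> (\<Sum>v | x v \<noteq> 0. x v) = 1}"
    using assms(2) by (simp add: geometric_realization_def)
  ultimately show ?thesis
    by (auto simp: continuous_map_in_subtopology geometric_realization_def)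
qed

text \<open>The assumption on the base says that a star-shaped \<open>T\<close> contains at most its centre \<open>c\<close> as a
  base point, so that the straight-line motion keeps base points fixed.\<close>

lemma polyhedral_product_star_slab_homotopy_equivalent:
  fixes E :: "'i \<Rightarrow> 'a set"
  assumes m: "m \<notin> I" and K: "down_closed K"
    and T: "T \<subseteq> topspace (cone_space (E m))" and c: "c \<in> T"
    and star: "\<And>t y. t \<in> {0..1} \<Longrightarrow> y \<in> T \<Longrightarrow> segment c (t, y) \<in> T"
    and base: "\<And>y. y \<in> T \<Longrightarrow> y None = 0 \<Longrightarrow> c = y"
  shows "subtopology (polyhedral_product (insert m I) K (\<lambda>i. cone_space (E i)) (\<lambda>i. cone_base (E i))) {x. x m \<in> T}
    homotopy_equivalent_space polyhedral_product I {J. J \<subseteq> I \<and> (if c None = 0 then J else insert m J) \<in> K}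
      (\<lambda>i. cone_space (E i)) (\<lambda>i. cone_base (E i))"
proof -
  have cB: "c \<in> cone_base (E m) \<longleftrightarrow> c None = 0" using T c by (auto simp: cone_base_iff)
  have "continuous_map (prod_topology (top_of_set {0..1}) (subtopology (cone_space (E m)) T))
      (subtopology (cone_space (E m)) T) (segment c)"
    unfolding cone_space_def
    by (rule continuous_map_segment) (use star T in \<open>auto simp: cone_space_def\<close>)
  note * = polyhedral_product_slab_homotopy_equivalent[where A = "\<lambda>i. cone_space (E i)" and B = "\<lambda>i. cone_base (E i)", OF m K T c this]
  show ?thesis
    unfolding cB[symmetric]
  proof (rule *)
    fix t :: real and y assume ty: "t \<in> {0..1}" "y \<in> T" "y \<in> cone_base (E m)"
    then have "c = y" using base T by (auto simp: cone_base_iff)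
    then have "segment c (t, y) = y" by (auto simp: segment_def algebra_simps)
    then show "segment c (t, y) \<in> cone_base (E m)" using ty by simp
  qed (auto simp: segment_def)
qed

section \<open>The recursion over links and deletions\<close>

lemma has_rel_euler_open_Un:
  assumes "openin X U" "openin X W"
    and "has_rel_euler (subtopology X U) {} u"
    and "has_rel_euler (subtopology X W) {} w"
    and "has_rel_euler (subtopology X (U \<inter> W)) {} v"
  shows "has_rel_euler (subtopology X (U \<union> W)) {} (u + w - v)"
proof (rule has_rel_euler_Un)
  have UW: "openin X (U \<union> W)" using assms by auto
  show "openin (subtopology X (U \<union> W)) U" "openin (subtopology X (U \<union> W)) W"
    using assms by (auto simp: openin_open_subtopology[OF UW])
  show "U \<union> W = topspace (subtopology X (U \<union> W))"
    using openin_subset[OF UW] by auto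
  have "(U \<union> W) \<inter> U = U" "(U \<union> W) \<inter> W = W" "(U \<union> W) \<inter> (U \<inter> W) = U \<inter> W" by auto
  then show "has_rel_euler (subtopology (subtopology X (U \<union> W)) U) {} u"
    "has_rel_euler (subtopology (subtopology X (U \<union> W)) W) {} w"
    "has_rel_euler (subtopology (subtopology X (U \<union> W)) (U \<inter> W)) {} v"
    using assms by (simp_all add: subtopology_subtopology)
qed

text \<open>Cover the polyhedral product by the open slab where coordinate \<open>m\<close> is not a base point and, for
  each \<open>e \<in> E m\<close>, the open slab where it lies on the edge over \<open>e\<close> and differs from the cone
  vertex. The first slab and its intersections with the others contract to the link; each of
  the others contracts to the deletion. Distinct edges give disjoint slabs, so adjoining one of
  them changes the Euler characteristic by that of the deletion minus that of the link.\<close>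

lemma has_rel_euler_link_deletion:
  fixes E :: "'i \<Rightarrow> 'a set"
  assumes m: "m \<notin> I" and K: "down_closed K" and fin: "finite (E m)"
    and d: "has_rel_euler (polyhedral_product I {J. J \<subseteq> I \<and> J \<in> K} (\<lambda>i. cone_space (E i)) (\<lambda>i. cone_base (E i))) {} d"
    and l: "has_rel_euler (polyhedral_product I {J. J \<subseteq> I \<and> insert m J \<in> K} (\<lambda>i. cone_space (E i)) (\<lambda>i. cone_base (E i))) {} l"
  shows "has_rel_euler (polyhedral_product (insert m I) K (\<lambda>i. cone_space (E i)) (\<lambda>i. cone_base (E i))) {}
    (int (card (E m)) * d + (1 - int (card (E m))) * l)"
proof -
  let ?X = "polyhedral_product (insert m I) K (\<lambda>i. cone_space (E i)) (\<lambda>i. cone_base (E i))"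
  let ?C = "topspace (cone_space (E m))"
  have xm: "x m \<in> ?C" if "x \<in> topspace ?X" for x
    using that by (auto simp: topspace_polyhedral_product)
  define P where "P v = {x \<in> topspace ?X. 0 < x m v}" for v
  have openP: "openin ?X (P v)" for v
  proof -
    have "continuous_map ?X (cone_space (E m)) (\<lambda>x. x m)"
      by (rule continuous_map_polyhedral_product_projection) simp
    then have "continuous_map ?X euclideanreal (\<lambda>x. x m v)"
      by (simp add: cone_space_def geometric_realization_def continuous_map_in_subtopology continuous_map_componentwise_UNIV)
    from openin_continuous_map_preimage[OF this, of "{0<..}"] show ?thesis by (simp add: P_def)
  qed
  \<comment> \<open>The centre c decides between deletion and link: it is a base point iff its apex coordinate is 0.\<close>
  have piece: "has_rel_euler (subtopology ?X {x \<in> topspace ?X. x m \<in> T}) {} e"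
    if "T \<subseteq> ?C" "c \<in> T" "\<And>t y. t \<in> {0..1} \<Longrightarrow> y \<in> T \<Longrightarrow> segment c (t, y) \<in> T"
      "\<And>y. y \<in> T \<Longrightarrow> y None = 0 \<Longrightarrow> c = y"
      "e = (if c None = 0 then d else l)" for T c e
  proof -
    have "has_rel_euler (polyhedral_product I {J. J \<subseteq> I \<and> (if c None = 0 then J else insert m J) \<in> K}
      (\<lambda>i. cone_space (E i)) (\<lambda>i. cone_base (E i))) {} e"
      using d l that(5) by simp
    moreover have "polyhedral_product I {J. J \<subseteq> I \<and> (if c None = 0 then J else insert m J) \<in> K}
      (\<lambda>i. cone_space (E i)) (\<lambda>i. cone_base (E i)) homotopy_equivalent_space subtopology ?X {x. x m \<in> T}"
      using polyhedral_product_star_slab_homotopy_equivalent[where E = E, OF m K that(1-4)]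
      by (rule homotopy_equivalent_space_sym[THEN iffD1])
    ultimately have "has_rel_euler (subtopology ?X {x. x m \<in> T}) {} e"
      by (rule has_rel_euler_homotopy)
    moreover have "{x \<in> topspace ?X. x m \<in> T} = topspace ?X \<inter> {x. x m \<in> T}" by auto
    ultimately show ?thesis by (simp only: subtopology_restrict)
  qed
  have conv: "0 < (1 - t) * s + t * s'" if "t \<in> {0..1}" "0 < s" "0 < s'" for t s s' :: real
    using that by (cases "t = 1") (auto intro: add_pos_nonneg)
  have conv1: "(1 - t) * s + t * s' \<le> 1" if "t \<in> {0..1}" "s \<le> 1" "s' \<le> 1" for t s s' :: real
    using convex_bound_le[of s 1 s' "1 - t" t] that by simp
  have W: "has_rel_euler (subtopology ?X (P None)) {} l"
  proof -
    let ?T = "insert (vertex_point None) {cone_point e s | e s. e \<in> E m \<and> 0 < s \<and> s < 1}"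
    have "P None = {x \<in> topspace ?X. x m \<in> ?T}"
      using xm by (force simp: P_def topspace_cone_space)
    moreover have "has_rel_euler (subtopology ?X {x \<in> topspace ?X. x m \<in> ?T}) {} l"
    proof (rule piece[of _ "vertex_point None"])
      fix t :: real and y assume t: "t \<in> {0..1}" and "y \<in> ?T"
      then consider "y = vertex_point None" | e s where "y = cone_point e s" "e \<in> E m" "0 < s" "s < 1" by auto
      then show "segment (vertex_point None) (t, y) \<in> ?T"
      proof cases
        case 1
        then show ?thesis by (auto simp: segment_def vertex_point_def)
      next
        case (2 e s)
        have eq: "segment (vertex_point None) (t, y) = cone_point e ((1 - t) * s)"
          using segment_cone_point[of e 0 t s] 2(1) by (simp add: cone_point_0)
        have "(1 - t) * s < 1"
        proof -
          have "(1 - t) * s \<le> 1 * s" using t 2 by (intro mult_right_mono) auto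
          then show ?thesis using 2(4) by linarith
        qed
        moreover have "0 < (1 - t) * s" if "t \<noteq> 1" using t 2 that by simp
        ultimately show ?thesis using 2(2) unfolding eq by (cases "t = 1") (auto simp: cone_point_0)
      qed
    next
      show "?T \<subseteq> ?C"
        by (auto intro!: cone_point_in_cone_space apex_in_cone_space)
    qed auto
    ultimately show ?thesis by simp
  qed
  have U: "has_rel_euler (subtopology ?X (P (Some e))) {} d" if e: "e \<in> E m" for e
  proof -
    let ?T = "{cone_point e s | s. 0 < s \<and> s \<le> 1}"
    have "P (Some e) = {x \<in> topspace ?X. x m \<in> ?T}"
      using xm e by (force simp: P_def topspace_cone_space split: if_splits)
    moreover have "has_rel_euler (subtopology ?X {x \<in> topspace ?X. x m \<in> ?T}) {} d"
    proof (rule piece[of _ "cone_point e 1"])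
      show "?T \<subseteq> ?C" using e by (auto intro!: cone_point_in_cone_space)
      show "segment (cone_point e 1) (t, y) \<in> ?T" if ty: "t \<in> {0..1}" "y \<in> ?T" for t y
      proof -
        obtain s where s: "y = cone_point e s" "0 < s" "s \<le> 1" using ty(2) by auto
        show ?thesis
          using conv[OF ty(1) s(2), of 1] conv1[OF ty(1) s(3), of 1]
          unfolding s(1) segment_cone_point by auto
      qed
    qed auto
    ultimately show ?thesis by simp
  qed
  have UW: "has_rel_euler (subtopology ?X (P None \<inter> P (Some e))) {} l" if e: "e \<in> E m" for e
  proof -
    let ?T = "{cone_point e s | s. 0 < s \<and> s < 1}"
    have "P None \<inter> P (Some e) = {x \<in> topspace ?X. x m \<in> ?T}"
      using xm e by (force simp: P_def topspace_cone_space split: if_splits)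
    moreover have "has_rel_euler (subtopology ?X {x \<in> topspace ?X. x m \<in> ?T}) {} l"
    proof (rule piece[of _ "cone_point e (1/2)"])
      show "?T \<subseteq> ?C" using e by (auto intro!: cone_point_in_cone_space)
      show "segment (cone_point e (1/2)) (t, y) \<in> ?T" if ty: "t \<in> {0..1}" "y \<in> ?T" for t y
      proof -
        obtain s where s: "y = cone_point e s" "0 < s" "s < 1" using ty(2) by auto
        show ?thesis
          using conv[OF ty(1) s(2), of "1/2"] convex_bound_lt[OF s(3), of "1/2" "1 - t" t] ty(1)
          unfolding s(1) segment_cone_point by auto
      qed
      show "cone_point e (1/2) \<in> ?T" by (intro CollectI exI[of _ "1/2"]) auto
    qed auto
    ultimately show ?thesis by simp
  qed
  have disj: "P (Some e) \<inter> P (Some e') = {}" if "e \<noteq> e'" for e e'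
    using xm that by (force simp: P_def topspace_cone_space split: if_splits)
  have "has_rel_euler (subtopology ?X (P None \<union> (\<Union>e\<in>F. P (Some e)))) {} (l + int (card F) * (d - l))"
    if "finite F" "F \<subseteq> E m" for F
    using that
  proof (induction F rule: finite_induct)
    case empty
    then show ?case using W by simp
  next
    case (insert e F)
    let ?G = "P None \<union> (\<Union>e\<in>F. P (Some e))"
    have "P (Some e') \<inter> P (Some e) = {}" if "e' \<in> F" for e'
      using that insert.hyps(2) by (intro disj) auto
    then have inter: "?G \<inter> P (Some e) = P None \<inter> P (Some e)" by auto
    have "has_rel_euler (subtopology ?X (?G \<union> P (Some e))) {} (l + int (card F) * (d - l) + d - l)"
    proof (rule has_rel_euler_open_Un)
      show "openin ?X ?G" using openP by (intro openin_Un openin_Union) auto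
      show "has_rel_euler (subtopology ?X ?G) {} (l + int (card F) * (d - l))"
        using insert.IH insert.prems by simp
      show "has_rel_euler (subtopology ?X (?G \<inter> P (Some e))) {} l"
        unfolding inter using insert.prems by (intro UW) simp
    qed (use openP U insert.prems in auto)
    moreover have "?G \<union> P (Some e) = P None \<union> (\<Union>e\<in>insert e F. P (Some e))" by auto
    moreover have "l + int (card F) * (d - l) + d - l = l + int (card (insert e F)) * (d - l)"
      using insert.hyps by (simp add: algebra_simps)
    ultimately show ?case by (simp only:)
  qed
  from this[OF fin order_refl]
  have "has_rel_euler (subtopology ?X (P None \<union> (\<Union>e\<in>E m. P (Some e)))) {} (l + int (card (E m)) * (d - l))" .
  moreover have "P None \<union> (\<Union>e\<in>E m. P (Some e)) = topspace ?X"
    using xm by (force simp: P_def topspace_cone_space)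
  ultimately show ?thesis by (simp add: algebra_simps)
qed

text \<open>The combinatorial side of the same recursion: split the simplices by whether they contain \<open>m\<close>.\<close>

lemma sum_over_link_and_deletion:
  fixes a b :: "'v \<Rightarrow> 'r::comm_ring_1"
  assumes fin: "finite I" and m: "m \<notin> I" and K: "K \<subseteq> Pow (insert m I)"
  shows "(\<Sum>J\<in>K. prod a J * prod b (insert m I - J)) =
      b m * (\<Sum>J | J \<subseteq> I \<and> J \<in> K. prod a J * prod b (I - J)) +
      a m * (\<Sum>J | J \<subseteq> I \<and> insert m J \<in> K. prod a J * prod b (I - J))"
proof -
  let ?D = "{J. J \<subseteq> I \<and> J \<in> K}" and ?L = "{J. J \<subseteq> I \<and> insert m J \<in> K}"
  have finDL: "finite ?D" "finite ?L" using fin by (auto intro: finite_subset[of _ "Pow I"])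
  have split: "K = ?D \<union> insert m ` ?L"
  proof (intro equalityI subsetI)
    fix J assume J: "J \<in> K"
    show "J \<in> ?D \<union> insert m ` ?L"
    proof (cases "m \<in> J")
      case True
      then have "J = insert m (J - {m})" by auto
      moreover from this have "J - {m} \<in> ?L" using J K by auto
      ultimately show ?thesis by blast
    qed (use J K in auto)
  qed auto
  have disj: "?D \<inter> insert m ` ?L = {}" using m by auto
  have inj: "inj_on (insert m) ?L" using m by (auto simp: inj_on_def)
  have 1: "prod a J * prod b (insert m I - J) = b m * (prod a J * prod b (I - J))" if "J \<in> ?D" for J
  proof -
    have "insert m I - J = insert m (I - J)" using that m by auto
    then show ?thesis using fin m by (simp add: mult_ac)
  qed
  have 2: "prod a (insert m J) * prod b (insert m I - insert m J) = a m * (prod a J * prod b (I - J))" if "J \<in> ?L" for J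
  proof -
    have "insert m I - insert m J = I - J" "m \<notin> J" "finite J" using that m fin finite_subset by auto
    then show ?thesis by (simp add: mult_ac)
  qed
  have "(\<Sum>J\<in>K. prod a J * prod b (insert m I - J)) =
      (\<Sum>J\<in>?D. prod a J * prod b (insert m I - J)) + (\<Sum>J\<in>insert m ` ?L. prod a J * prod b (insert m I - J))"
    using finDL disj by (subst split) (simp add: sum.union_disjoint)
  then show ?thesis
    using 1 2 by (simp add: sum.reindex[OF inj] sum_distrib_left)
qed

theorem has_rel_euler_polyhedral_product_cone:
  fixes E :: "'i \<Rightarrow> 'a set"
  assumes "finite I" "K \<subseteq> Pow I" "down_closed K" "\<And>i. i \<in> I \<Longrightarrow> finite (E i)"
  shows "has_rel_euler (polyhedral_product I K (\<lambda>i. cone_space (E i)) (\<lambda>i. cone_base (E i))) {}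
    (\<Sum>J\<in>K. (\<Prod>j\<in>J. 1 - int (card (E j))) * (\<Prod>i\<in>I - J. int (card (E i))))"
  using assms
proof (induction I arbitrary: K rule: finite_induct)
  case empty
  then consider "K = {}" | "K = {{}}" by auto
  then show ?case
  proof cases
    case 1
    then show ?thesis by (auto intro!: has_rel_euler_empty simp: topspace_polyhedral_product)
  next
    case 2
    then show ?thesis
      by (auto intro!: has_rel_euler_singleton[where a = "\<lambda>_. undefined"] simp: topspace_polyhedral_product point_support_def)
  qed
next
  case (insert m I)
  note IH = insert.IH[OF _ _ insert.prems(3)[OF insertI2]]
  have "has_rel_euler (polyhedral_product (insert m I) K (\<lambda>i. cone_space (E i)) (\<lambda>i. cone_base (E i))) {}
    (int (card (E m)) * (\<Sum>J | J \<subseteq> I \<and> J \<in> K. (\<Prod>j\<in>J. 1 - int (card (E j))) * (\<Prod>i\<in>I - J. int (card (E i))))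
     + (1 - int (card (E m))) * (\<Sum>J | J \<subseteq> I \<and> insert m J \<in> K. (\<Prod>j\<in>J. 1 - int (card (E j))) * (\<Prod>i\<in>I - J. int (card (E i)))))"
  proof (rule has_rel_euler_link_deletion[OF insert.hyps(2) insert.prems(2)])
    show "finite (E m)" using insert.prems(3) by simp
    show "has_rel_euler (polyhedral_product I {J. J \<subseteq> I \<and> J \<in> K} (\<lambda>i. cone_space (E i)) (\<lambda>i. cone_base (E i))) {}
        (\<Sum>J | J \<subseteq> I \<and> J \<in> K. (\<Prod>j\<in>J. 1 - int (card (E j))) * (\<Prod>i\<in>I - J. int (card (E i))))"
      by (rule IH) (use insert.prems(2) in \<open>unfold down_closed_def, blast+\<close>)
    show "has_rel_euler (polyhedral_product I {J. J \<subseteq> I \<and> insert m J \<in> K} (\<lambda>i. cone_space (E i)) (\<lambda>i. cone_base (E i))) {}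
        (\<Sum>J | J \<subseteq> I \<and> insert m J \<in> K. (\<Prod>j\<in>J. 1 - int (card (E j))) * (\<Prod>i\<in>I - J. int (card (E i))))"
    proof (rule IH)
      show "down_closed {J. J \<subseteq> I \<and> insert m J \<in> K}"
        unfolding down_closed_def
      proof (intro ballI allI impI CollectI conjI)
        fix \<sigma> \<tau> assume "\<sigma> \<in> {J. J \<subseteq> I \<and> insert m J \<in> K}" "\<tau> \<subseteq> \<sigma>"
        then have st: "\<sigma> \<subseteq> I" "insert m \<sigma> \<in> K" "insert m \<tau> \<subseteq> insert m \<sigma>" "\<tau> \<subseteq> \<sigma>" by auto
        then show "\<tau> \<subseteq> I" by blast
        show "insert m \<tau> \<in> K" using st(2,3) insert.prems(2) unfolding down_closed_def by blast
      qed
    qed auto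
  qed
  then show ?case
    using sum_over_link_and_deletion[OF insert.hyps insert.prems(1), of "\<lambda>j. 1 - int (card (E j))" "\<lambda>i. int (card (E i))"]
    by simp
qed

section \<open>Values of the h-polynomial\<close>

lemma mpoly_eval_diff: "mpoly_eval t (p - q) = mpoly_eval t p - mpoly_eval t q"
  using mpoly_eval_add[of t "p - q" q] by simp

text \<open>Peeling off one factor \<open>1 - indet i\<close> writes the product as a difference of two products of the
  same shape, so additivity of evaluation and its value on squarefree monomials suffice.\<close>

lemma mpoly_eval_prod_indet_compl:
  assumes "finite J" "finite I" "J \<inter> I = {}"
  shows "mpoly_eval t ((\<Prod>j\<in>J. indet j) * (\<Prod>i\<in>I. 1 - indet i)) = (\<Prod>j\<in>J. t j) * (\<Prod>i\<in>I. 1 - t i)"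
  using assms(2,1,3)
proof (induction I arbitrary: J rule: finite_induct)
  case empty
  then show ?case by (simp add: mpoly_eval_prod_indet)
next
  case (insert i I)
  have "(\<Prod>j\<in>J. indet j) * (\<Prod>i\<in>insert i I. 1 - indet i) =
      (\<Prod>j\<in>J. indet j) * (\<Prod>i\<in>I. 1 - indet i) - (\<Prod>j\<in>insert i J. indet j) * (\<Prod>i\<in>I. 1 - indet i)"
    using insert by (simp add: algebra_simps)
  then show ?case
    using insert insert.IH[of J] insert.IH[of "insert i J"] by (simp add: mpoly_eval_diff algebra_simps)
qed

lemma mpoly_eval_h_hat_poly:
  assumes "finite_simplicial_complex V K"
  shows "mpoly_eval t (h_hat_poly V K) = (\<Sum>J\<in>K. (\<Prod>j\<in>J. t j) * (\<Prod>i\<in>V - J. 1 - t i))"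
  unfolding h_hat_poly_eq(1)[OF assms] mpoly_eval_sum
proof (rule sum.cong[OF refl])
  fix J assume "J \<in> K"
  then have "finite J" "finite (V - J)" "J \<inter> (V - J) = {}"
    using assms by (auto simp: finite_simplicial_complex_def intro: finite_subset)
  then show "mpoly_eval t ((\<Prod>j\<in>J. indet j) * (\<Prod>i\<in>V - J. 1 - indet i)) = (\<Prod>j\<in>J. t j) * (\<Prod>i\<in>V - J. 1 - t i)"
    by (rule mpoly_eval_prod_indet_compl)
qed

theorem corollary2:
  fixes m :: nat
    and L :: "nat set set"
    and E :: "nat \<Rightarrow> 'a set"
    and q :: "nat \<Rightarrow> int"
  assumes "finite_simplicial_complex {1..m} L"
    and "\<And>i. i \<in> {1..m} \<Longrightarrow> finite (E i)"
    and "\<And>i. i \<in> {1..m} \<Longrightarrow> int (card (E i)) = q i + 1"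
  shows "euler_characteristic
           (polyhedral_product {1..m} L (\<lambda>i. cone_space (E i)) (\<lambda>i. cone_base (E i)))
         = mpoly_eval (\<lambda>i. - q i) (h_hat_poly {1..m} L)"
proof -
  have L: "L \<subseteq> Pow {1..m}" "down_closed L"
    using assms(1) by (auto simp: finite_simplicial_complex_def down_closed_def)
  have "euler_characteristic (polyhedral_product {1..m} L (\<lambda>i. cone_space (E i)) (\<lambda>i. cone_base (E i))) =
      (\<Sum>J\<in>L. (\<Prod>j\<in>J. 1 - int (card (E j))) * (\<Prod>i\<in>{1..m} - J. int (card (E i))))"
    by (intro has_rel_euler_imp_euler_characteristic has_rel_euler_polyhedral_product_cone)
      (use L assms(2) in auto)
  also have "\<dots> = (\<Sum>J\<in>L. (\<Prod>j\<in>J. - q j) * (\<Prod>i\<in>{1..m} - J. 1 - (- q i)))"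
  proof (intro sum.cong[OF refl] arg_cong2[where f = "(*)"] prod.cong[OF refl])
    show "1 - int (card (E j)) = - q j" if "J \<in> L" "j \<in> J" for J j
    proof -
      have "j \<in> {1..m}" using L(1) that by blast
      then show ?thesis using assms(3) by simp
    qed
  qed (use assms(3) in auto)
  also have "\<dots> = mpoly_eval (\<lambda>i. - q i) (h_hat_poly {1..m} L)"
    by (simp only: mpoly_eval_h_hat_poly[OF assms(1)])
  finally show ?thesis .
qed

end
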